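(* Let $n\ge1$. The operators $P_T, Q_{\Pi,(1)},\dots,Q_{\Pi,(n)}$ on $(\mathcal{A}^2(\Pi))^n$ form a system of all-but-one orthogonal projections in generic position.
   Context: $\Pi=\{z=x+iy\in\mathbb{C}:y>0\}$ with Lebesgue area measure; $\mathcal{A}^2(\Pi)$ is the Bergman space of holomorphic functions in $L_2(\Pi)$. For a bounded measurable $a$ on $\Pi$, the Toeplitz operator $T_a:\mathcal{A}^2(\Pi)\to\mathcal{A}^2(\Pi)$ is $T_af=B(af)$, with $B$ the orthogonal projection of $L_2(\Pi)$ onto $\mathcal{A}^2(\Pi)$. For $1\le k\le n-1$ let $a_k(z)=\chi_{[k-1,k)}(\operatorname{Im}z)$, and let $a_n(z)=\chi_{[n-1,\infty)}(\operatorname{Im}z)$. Define on $(\mathcal{A}^2(\Pi))^n$ (column vectors with the usual inner product) $P_T=\left(\sqrt{T_{a_j}}\sqrt{T_{a_k}}\right)_{j,k=1,\dots,n}$ (the $T_{a_k}$ are positive operators), and $Q_{\Pi,(j)}(f_1,\dots,f_n)^t=(0,\dots,f_j,\dots,0)^t$ (with $f_j$ in position $j$). Orthogonal projections $P,P_1,\dots,P_n$ on a Hilbert space form a system of all-but-one orthogonal projections in generic position if $(\operatorname{Im}P)^\perp\cap\operatorname{Im}P_j=\{0\}=\operatorname{Im}P\cap(\operatorname{Im}P_j)^\perp$ for all $j=1,\dots,n$. *)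

theory Defs
  imports "HOL-Complex_Analysis.Complex_Analysis" "HOL-Library.Function_Algebras"
    "HOL-Library.FuncSet"
begin

text \<open>
  Complex Hilbert spaces are carrier sets inside an ambient additive group, with explicit scalar
  multiplication and inner product (linear in the first argument).
\<close>

record 'v ip_space =
  hcarrier :: "'v set"
  hscale :: "complex \<Rightarrow> 'v \<Rightarrow> 'v"
  hinner :: "'v \<Rightarrow> 'v \<Rightarrow> complex"

definition hnorm :: "'v ip_space \<Rightarrow> 'v \<Rightarrow> real" where
  "hnorm H x = sqrt (Re (hinner H x x))"

locale hilbert_space = vector_space "hscale H" for H :: "'v::ab_group_add ip_space" +
  assumes subspace_carrier: "subspace (hcarrier H)"
    and inner_add_left: "\<lbrakk>x \<in> hcarrier H; y \<in> hcarrier H; z \<in> hcarrier H\<rbrakk> \<Longrightarrow>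
      hinner H (x + y) z = hinner H x z + hinner H y z"
    and inner_scale_left: "\<lbrakk>x \<in> hcarrier H; y \<in> hcarrier H\<rbrakk> \<Longrightarrow>
      hinner H (hscale H c x) y = c * hinner H x y"
    and inner_cnj: "\<lbrakk>x \<in> hcarrier H; y \<in> hcarrier H\<rbrakk> \<Longrightarrow> hinner H y x = cnj (hinner H x y)"
    and inner_pos: "\<lbrakk>x \<in> hcarrier H; x \<noteq> 0\<rbrakk> \<Longrightarrow> 0 < Re (hinner H x x)"
    and complete: "\<lbrakk>\<And>i::nat. X i \<in> hcarrier H;
        \<forall>e>0. \<exists>N. \<forall>i\<ge>N. \<forall>j\<ge>N. hnorm H (X i - X j) < e\<rbrakk> \<Longrightarrow>
      \<exists>x\<in>hcarrier H. (\<lambda>i. hnorm H (X i - x)) \<longlonglongrightarrow> 0"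

definition bounded_operator :: "'v::ab_group_add ip_space \<Rightarrow> ('v \<Rightarrow> 'v) \<Rightarrow> bool" where
  "bounded_operator H T \<longleftrightarrow>
     (\<forall>x\<in>hcarrier H. T x \<in> hcarrier H) \<and>
     (\<forall>x\<in>hcarrier H. \<forall>y\<in>hcarrier H. T (x + y) = T x + T y) \<and>
     (\<forall>c. \<forall>x\<in>hcarrier H. T (hscale H c x) = hscale H c (T x)) \<and>
     (\<exists>M. \<forall>x\<in>hcarrier H. hnorm H (T x) \<le> M * hnorm H x)"

definition self_adjoint_operator :: "'v::ab_group_add ip_space \<Rightarrow> ('v \<Rightarrow> 'v) \<Rightarrow> bool" where
  "self_adjoint_operator H T \<longleftrightarrow> bounded_operator H T \<and>
     (\<forall>x\<in>hcarrier H. \<forall>y\<in>hcarrier H. hinner H (T x) y = hinner H x (T y))"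

definition positive_operator :: "'v::ab_group_add ip_space \<Rightarrow> ('v \<Rightarrow> 'v) \<Rightarrow> bool" where
  "positive_operator H T \<longleftrightarrow> self_adjoint_operator H T \<and>
     (\<forall>x\<in>hcarrier H. 0 \<le> Re (hinner H (T x) x))"

text \<open>
  The positive square root. It is determined on the carrier only; \<^const>\<open>extensional\<close> fixes
  its values elsewhere, so that the description is unique.
\<close>

definition operator_sqrt :: "'v::ab_group_add ip_space \<Rightarrow> ('v \<Rightarrow> 'v) \<Rightarrow> 'v \<Rightarrow> 'v" where
  "operator_sqrt H T = (THE S. positive_operator H S \<and>
     (\<forall>x\<in>hcarrier H. S (S x) = T x) \<and> S \<in> extensional (hcarrier H))"

definition orthogonal_projection :: "'v::ab_group_add ip_space \<Rightarrow> ('v \<Rightarrow> 'v) \<Rightarrow> bool" where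
  "orthogonal_projection H P \<longleftrightarrow> self_adjoint_operator H P \<and>
     (\<forall>x\<in>hcarrier H. P (P x) = P x)"

definition ortho_complement :: "'v ip_space \<Rightarrow> 'v set \<Rightarrow> 'v set" where
  "ortho_complement H S = {x \<in> hcarrier H. \<forall>y\<in>S. hinner H x y = 0}"

definition all_but_one_generic_position ::
  "'v::ab_group_add ip_space \<Rightarrow> nat \<Rightarrow> ('v \<Rightarrow> 'v) \<Rightarrow> (nat \<Rightarrow> 'v \<Rightarrow> 'v) \<Rightarrow> bool" where
  "all_but_one_generic_position H n P Q \<longleftrightarrow>
     hilbert_space H \<and> orthogonal_projection H P \<and>
     (\<forall>j\<in>{1..n}. orthogonal_projection H (Q j)) \<and>
     (\<forall>j\<in>{1..n}.
        ortho_complement H (P ` hcarrier H) \<inter> Q j ` hcarrier H = {0} \<and>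
        P ` hcarrier H \<inter> ortho_complement H (Q j ` hcarrier H) = {0})"

text \<open>The \<open>n\<close>-fold direct sum: families indexed by \<open>{1..n}\<close>, extended by \<open>0\<close>.\<close>

definition hilbert_power :: "'v::ab_group_add ip_space \<Rightarrow> nat \<Rightarrow> (nat \<Rightarrow> 'v) ip_space" where
  "hilbert_power H n = \<lparr>
     hcarrier = {f. (\<forall>k\<in>{1..n}. f k \<in> hcarrier H) \<and> (\<forall>k. k \<notin> {1..n} \<longrightarrow> f k = 0)},
     hscale = (\<lambda>c f k. hscale H c (f k)),
     hinner = (\<lambda>f g. \<Sum>k=1..n. hinner H (f k) (g k))\<rparr>"

definition upper_half_plane :: "complex set" where
  "upper_half_plane = {z. 0 < Im z}"

definition L2_functions :: "(complex \<Rightarrow> complex) set" where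
  "L2_functions = {f. f \<in> borel_measurable (lebesgue_on upper_half_plane) \<and>
     integrable (lebesgue_on upper_half_plane) (\<lambda>z. (norm (f z))\<^sup>2)}"

definition L2_inner :: "(complex \<Rightarrow> complex) \<Rightarrow> (complex \<Rightarrow> complex) \<Rightarrow> complex" where
  "L2_inner f g = integral\<^sup>L (lebesgue_on upper_half_plane) (\<lambda>z. f z * cnj (g z))"

text \<open>
  Each class in the Bergman space has a unique holomorphic representative on the half-plane;
  its values outside the half-plane are set to \<open>0\<close>, so that equality of elements is equality
  of functions.
\<close>

definition bergman_space :: "(complex \<Rightarrow> complex) ip_space" where
  "bergman_space = \<lparr>
     hcarrier = {f. f holomorphic_on upper_half_plane \<and> f \<in> L2_functions \<and>
       (\<forall>z. z \<notin> upper_half_plane \<longrightarrow> f z = 0)},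
     hscale = (\<lambda>c f z. c * f z),
     hinner = L2_inner\<rparr>"

definition bergman_projection :: "(complex \<Rightarrow> complex) \<Rightarrow> complex \<Rightarrow> complex" where
  "bergman_projection f = (THE g. g \<in> hcarrier bergman_space \<and>
     (\<forall>h\<in>hcarrier bergman_space. L2_inner (\<lambda>z. f z - g z) h = 0))"

definition toeplitz ::
  "(complex \<Rightarrow> complex) \<Rightarrow> (complex \<Rightarrow> complex) \<Rightarrow> complex \<Rightarrow> complex" where
  "toeplitz a f = bergman_projection (\<lambda>z. a z * f z)"

definition strip_symbol :: "nat \<Rightarrow> nat \<Rightarrow> complex \<Rightarrow> complex" where
  "strip_symbol n k z =
     (if k < n then indicator {real k - 1..<real k} (Im z) else indicator {real n - 1..} (Im z))"

definition sqrt_toeplitz :: "nat \<Rightarrow> nat \<Rightarrow> (complex \<Rightarrow> complex) \<Rightarrow> complex \<Rightarrow> complex" where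
  "sqrt_toeplitz n k = operator_sqrt bergman_space (toeplitz (strip_symbol n k))"

definition P_T :: "nat \<Rightarrow> (nat \<Rightarrow> complex \<Rightarrow> complex) \<Rightarrow> nat \<Rightarrow> complex \<Rightarrow> complex" where
  "P_T n f = (\<lambda>j. if j \<in> {1..n}
     then \<Sum>k=1..n. sqrt_toeplitz n j (sqrt_toeplitz n k (f k)) else 0)"

definition Q_Pi :: "nat \<Rightarrow> (nat \<Rightarrow> complex \<Rightarrow> complex) \<Rightarrow> nat \<Rightarrow> complex \<Rightarrow> complex" where
  "Q_Pi j f = (\<lambda>k. if k = j then f j else 0)"

end

theory Submission
  imports Defs
begin

text \<open>
  Put \<open>S\<^sub>k = \<surd>T\<^sub>a\<^sub>k\<close> and \<open>V g = (S\<^sub>1 g, \<dots>, S\<^sub>n g)\<close>. The symbols add up to \<open>1\<close> on the half-plane, so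
  \<open>V\<^sup>* V = \<Sum>\<^sub>k S\<^sub>k\<^sup>2 = \<Sum>\<^sub>k T\<^sub>a\<^sub>k = 1\<close>: \<open>V\<close> is an isometry of the Bergman space into its \<open>n\<close>-th power, and
  \<open>P\<^sub>T = V V\<^sup>*\<close> is the orthogonal projection onto its range. A vector \<open>f\<close> supported in position \<open>j\<close>
  is orthogonal to that range iff \<open>V\<^sup>* f = S\<^sub>j f\<^sub>j\<close> vanishes, and \<open>V g\<close> is orthogonal to all vectors
  supported in position \<open>j\<close> iff \<open>S\<^sub>j g = 0\<close>. Generic position therefore amounts to injectivity of
  every \<open>S\<^sub>j\<close> (theorem \<open>all_but_one_generic_position_of_resolution\<close>). It follows from injectivity of
  \<open>T\<^sub>a\<^sub>j = S\<^sub>j\<^sup>2\<close>: if \<open>T\<^sub>a\<^sub>j f = 0\<close>, then \<open>\<integral> a\<^sub>j |f|\<^sup>2 = \<langle>T\<^sub>a\<^sub>j f, f\<rangle> = 0\<close>, so \<open>f\<close> vanishes on an open strip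
  and hence everywhere by the identity theorem (lemma \<open>toeplitz_indicator_injective\<close>).

  Three facts from analysis make these objects meaningful. The Bergman space is complete: Cauchy's
  formula, averaged over discs of centres, bounds point evaluations by the norm, so that norm
  Cauchy sequences converge locally uniformly, and Fatou's lemma turns the locally uniform limit
  into a limit in norm (lemma \<open>bergman_complete\<close>). The Bergman projection exists by Riesz
  representation. A self-adjoint \<open>T\<close> with \<open>\<parallel>1 - T\<parallel> \<le> 1\<close> has exactly one positive square root
  (theorem \<open>operator_sqrt\<close>): it is \<open>1 - B\<close>, where \<open>B\<close> solves \<open>B = ((1 - T) + B\<^sup>2) / 2\<close> and is
  obtained by iterating this equation.
\<close>

section \<open>Geometry of Hilbert spaces\<close>

text \<open>
  The discriminant argument behind the Cauchy-Schwarz inequality, separated from any particular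
  form: it is used for Hilbert spaces and also for \<open>L\<^sub>2\<close>, where the form is only semidefinite on
  functions, so that \<open>b = 0\<close> is possible for a nonzero vector.
\<close>

lemma Cauchy_Schwarz_of_nonneg_form:
  fixes z :: complex and a b :: real
  assumes form: "\<And>c. 0 \<le> a - 2 * Re (cnj c * z) + (cmod c)\<^sup>2 * b" and b: "0 \<le> b"
  shows "(cmod z)\<^sup>2 \<le> a * b"
proof -
  define m where "m = (cmod z)\<^sup>2"
  have a: "0 \<le> a" using form[of 0] by simp
  have line: "0 \<le> a - 2 * t * m + t\<^sup>2 * m * b" for t :: real
  proof -
    have "cnj (of_real t * z) * z = of_real (t * m)"
      unfolding m_def by (simp add: complex_norm_square mult_ac del: of_real_power)
    then have "Re (cnj (of_real t * z) * z) = t * m" by (simp only: Re_complex_of_real)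
    then show ?thesis using form[of "of_real t * z"]
      by (simp add: norm_mult power_mult_distrib m_def[symmetric])
  qed
  show ?thesis
  proof (cases "m = 0 \<or> b = 0")
    case True
    then show ?thesis
    proof
      assume "m = 0" then show ?thesis using a b by (simp add: m_def)
    next
      assume b0: "b = 0"
      have "m = 0"
      proof (rule ccontr)
        assume m: "m \<noteq> 0"
        \<comment> \<open>With \<open>b = 0\<close> the form is affine in \<open>t\<close>; at this \<open>t\<close> it equals \<open>- a - 2 < 0\<close>.\<close>
        show False using line[of "(a + 1) / m"] b0 m a by simp
      qed
      then show ?thesis using b0 by (simp add: m_def)
    qed
  next
    case False
    then have "0 < b" using b by simp
    then have "0 \<le> a - m / b" using line[of "1 / b"] by (simp add: power2_eq_square field_simps)
    then show ?thesis using \<open>0 < b\<close> by (simp add: field_simps m_def)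
  qed
qed

lemma linear_coefficient_zero_of_nonneg_quadratic:
  fixes p q :: real
  assumes "\<And>t. 0 \<le> t * p + t\<^sup>2 * q" shows "p = 0"
proof (rule ccontr)
  assume p: "p \<noteq> 0"
  define s where "s = \<bar>q\<bar> + 1"
  have s: "0 < s" "q < s" by (auto simp: s_def)
  \<comment> \<open>For \<open>t = - p / s\<close> with \<open>s > q\<close> the linear term dominates the quadratic one.\<close>
  have "0 \<le> (- p / s) * p + (- p / s)\<^sup>2 * q" by (rule assms)
  also have "\<dots> = p\<^sup>2 * (q - s) / s\<^sup>2" using s by (simp add: field_simps power2_eq_square)
  also have "\<dots> < 0" using s p by (simp add: divide_neg_pos mult_pos_neg)
  finally show False by simp
qed

context hilbert_space
begin

lemma zero_closed [simp]: "0 \<in> hcarrier H"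
  and add_closed [simp]: "x \<in> hcarrier H \<Longrightarrow> y \<in> hcarrier H \<Longrightarrow> x + y \<in> hcarrier H"
  and scale_closed [simp]: "x \<in> hcarrier H \<Longrightarrow> hscale H c x \<in> hcarrier H"
  and diff_closed [simp]: "x \<in> hcarrier H \<Longrightarrow> y \<in> hcarrier H \<Longrightarrow> x - y \<in> hcarrier H"
  and sum_closed: "(\<And>i. i \<in> I \<Longrightarrow> f i \<in> hcarrier H) \<Longrightarrow> sum f I \<in> hcarrier H"
  using subspace_0 subspace_add subspace_scale subspace_diff subspace_sum subspace_carrier
  by metis+

declare inner_add_left [simp] inner_scale_left [simp]

lemma inner_zero_left [simp]: "y \<in> hcarrier H \<Longrightarrow> hinner H 0 y = 0"
  using inner_scale_left[of 0 y 0] by simp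

lemma inner_diff_left [simp]:
  assumes "x \<in> hcarrier H" "y \<in> hcarrier H" "z \<in> hcarrier H"
  shows "hinner H (x - y) z = hinner H x z - hinner H y z"
  using inner_add_left[of "x - y" y z] assms by simp

lemma inner_add_right [simp]:
  assumes "x \<in> hcarrier H" "y \<in> hcarrier H" "z \<in> hcarrier H"
  shows "hinner H z (x + y) = hinner H z x + hinner H z y"
  using assms inner_cnj[of _ z] by (metis add_closed inner_add_left complex_cnj_add)

lemma inner_diff_right [simp]:
  assumes "x \<in> hcarrier H" "y \<in> hcarrier H" "z \<in> hcarrier H"
  shows "hinner H z (x - y) = hinner H z x - hinner H z y"
  using assms inner_cnj[of _ z] by (metis diff_closed inner_diff_left complex_cnj_diff)

lemma inner_scale_right [simp]:
  assumes "x \<in> hcarrier H" "y \<in> hcarrier H"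
  shows "hinner H x (hscale H c y) = cnj c * hinner H x y"
  using assms inner_cnj[of _ x] by (metis scale_closed inner_scale_left complex_cnj_mult)

lemma inner_zero_right [simp]: "y \<in> hcarrier H \<Longrightarrow> hinner H y 0 = 0"
  using inner_scale_right[of y 0 0] by simp

lemma inner_sum_left:
  assumes "\<And>i. i \<in> I \<Longrightarrow> f i \<in> hcarrier H" "y \<in> hcarrier H"
  shows "hinner H (sum f I) y = (\<Sum>i\<in>I. hinner H (f i) y)"
  using assms by (induction I rule: infinite_finite_induct) (auto simp: sum_closed)

lemma inner_sum_right:
  assumes "\<And>i. i \<in> I \<Longrightarrow> f i \<in> hcarrier H" "y \<in> hcarrier H"
  shows "hinner H y (sum f I) = (\<Sum>i\<in>I. hinner H y (f i))"
  using assms by (induction I rule: infinite_finite_induct) (auto simp: sum_closed)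

lemma inner_self_nonneg: "x \<in> hcarrier H \<Longrightarrow> 0 \<le> Re (hinner H x x)"
  using inner_pos[of x] by (cases "x = 0") auto

lemma norm_nonneg [simp]: "x \<in> hcarrier H \<Longrightarrow> 0 \<le> hnorm H x"
  by (simp add: hnorm_def inner_self_nonneg)

lemma norm_square: "x \<in> hcarrier H \<Longrightarrow> (hnorm H x)\<^sup>2 = Re (hinner H x x)"
  by (simp add: hnorm_def inner_self_nonneg)

lemma inner_self: "x \<in> hcarrier H \<Longrightarrow> hinner H x x = of_real ((hnorm H x)\<^sup>2)"
  using inner_cnj[of x x] by (simp add: norm_square complex_eq_iff)

lemma norm_zero [simp]: "hnorm H 0 = 0"
  by (simp add: hnorm_def)

lemma norm_eq_zero: "x \<in> hcarrier H \<Longrightarrow> hnorm H x = 0 \<longleftrightarrow> x = 0"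
  using inner_pos[of x] by (fastforce simp: hnorm_def)

lemma norm_scale [simp]:
  "x \<in> hcarrier H \<Longrightarrow> hnorm H (hscale H c x) = cmod c * hnorm H x"
proof -
  assume x: "x \<in> hcarrier H"
  have "hinner H (hscale H c x) (hscale H c x) = (c * cnj c) * hinner H x x"
    using x by (simp add: mult_ac)
  also have "\<dots> = of_real ((cmod c * hnorm H x)\<^sup>2)"
    using x by (simp add: inner_self power_mult_distrib flip: complex_norm_square)
  finally show ?thesis using x by (simp only: hnorm_def[of H "hscale H c x"] Re_complex_of_real) simp
qed

lemma norm_add_square:
  "x \<in> hcarrier H \<Longrightarrow> y \<in> hcarrier H \<Longrightarrow>
    (hnorm H (x + y))\<^sup>2 = (hnorm H x)\<^sup>2 + 2 * Re (hinner H x y) + (hnorm H y)\<^sup>2"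
  using inner_cnj[of x y] by (simp add: norm_square)

lemma norm_diff_square:
  "x \<in> hcarrier H \<Longrightarrow> y \<in> hcarrier H \<Longrightarrow>
    (hnorm H (x - y))\<^sup>2 = (hnorm H x)\<^sup>2 - 2 * Re (hinner H x y) + (hnorm H y)\<^sup>2"
  using inner_cnj[of x y] by (simp add: norm_square)

lemma norm_minus_commute:
  "x \<in> hcarrier H \<Longrightarrow> y \<in> hcarrier H \<Longrightarrow> hnorm H (x - y) = hnorm H (y - x)"
  using inner_cnj[of x y] unfolding hnorm_def by simp

lemma Cauchy_Schwarz:
  assumes x: "x \<in> hcarrier H" and y: "y \<in> hcarrier H"
  shows "cmod (hinner H x y) \<le> hnorm H x * hnorm H y"
proof -
  have "(cmod (hinner H x y))\<^sup>2 \<le> (hnorm H x)\<^sup>2 * (hnorm H y)\<^sup>2"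
  proof (rule Cauchy_Schwarz_of_nonneg_form)
    fix c
    have "0 \<le> (hnorm H (x - hscale H c y))\<^sup>2" by simp
    then show "0 \<le> (hnorm H x)\<^sup>2 - 2 * Re (cnj c * hinner H x y) + (cmod c)\<^sup>2 * (hnorm H y)\<^sup>2"
      using x y by (simp only: norm_diff_square scale_closed inner_scale_right norm_scale
          power_mult_distrib)
  qed simp
  then show ?thesis
    using x y by (intro power2_le_imp_le[of "cmod _"]) (simp_all add: power_mult_distrib)
qed

lemma Re_inner_le:
  "x \<in> hcarrier H \<Longrightarrow> y \<in> hcarrier H \<Longrightarrow> Re (hinner H x y) \<le> hnorm H x * hnorm H y"
  using Cauchy_Schwarz[of x y] complex_Re_le_cmod[of "hinner H x y"] by linarith

lemma norm_triangle:
  assumes x: "x \<in> hcarrier H" and y: "y \<in> hcarrier H"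
  shows "hnorm H (x + y) \<le> hnorm H x + hnorm H y"
proof (rule power2_le_imp_le)
  show "(hnorm H (x + y))\<^sup>2 \<le> (hnorm H x + hnorm H y)\<^sup>2"
    using Re_inner_le[OF x y] norm_add_square[OF x y] by (simp add: power2_sum)
qed (use x y in simp)

lemma norm_triangle_sub:
  assumes "x \<in> hcarrier H" "y \<in> hcarrier H" "z \<in> hcarrier H"
  shows "hnorm H (x - z) \<le> hnorm H (x - y) + hnorm H (y - z)"
  using norm_triangle[of "x - y" "y - z"] assms by simp

lemma eq_if_inner_eq:
  assumes "x \<in> hcarrier H" "y \<in> hcarrier H"
    and "\<And>z. z \<in> hcarrier H \<Longrightarrow> hinner H x z = hinner H y z"
  shows "x = y"
proof -
  have "hinner H (x - y) (x - y) = 0" using assms by (simp del: inner_diff_right)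
  then show ?thesis using inner_pos[of "x - y"] assms by fastforce
qed

abbreviation converges_to :: "(nat \<Rightarrow> 'v) \<Rightarrow> 'v \<Rightarrow> bool" where
  "converges_to X x \<equiv> (\<lambda>i. hnorm H (X i - x)) \<longlonglongrightarrow> 0"

lemma converges_to_unique:
  assumes X: "\<And>i. X i \<in> hcarrier H" and x: "x \<in> hcarrier H" and y: "y \<in> hcarrier H"
    and "converges_to X x" "converges_to X y"
  shows "x = y"
proof -
  have "(\<lambda>i. hnorm H (X i - x) + hnorm H (X i - y)) \<longlonglongrightarrow> 0 + 0"
    using assms by (intro tendsto_add)
  then have "hnorm H (x - y) \<le> 0 + 0"
  proof (rule tendsto_lowerbound, intro always_eventually allI)
    show "hnorm H (x - y) \<le> hnorm H (X i - x) + hnorm H (X i - y)" for i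
      using norm_triangle_sub[OF x X[of i] y] norm_minus_commute[OF x X[of i]] by simp
  qed simp
  then have "hnorm H (x - y) = 0" using x y by (intro antisym) simp_all
  then show ?thesis using x y norm_eq_zero[of "x - y"] by simp
qed

lemma converges_to_inner:
  assumes X: "\<And>i. X i \<in> hcarrier H" and x: "x \<in> hcarrier H" and y: "y \<in> hcarrier H"
    and lim: "converges_to X x"
  shows "(\<lambda>i. hinner H (X i) y) \<longlonglongrightarrow> hinner H x y"
proof -
  have "(\<lambda>i. hnorm H (X i - x) * hnorm H y) \<longlonglongrightarrow> 0"
    using tendsto_mult_right[OF lim, of "hnorm H y"] by simp
  then have "(\<lambda>i. hinner H (X i) y - hinner H x y) \<longlonglongrightarrow> 0"
  proof (rule Lim_null_comparison[rotated], intro always_eventually allI)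
    show "cmod (hinner H (X i) y - hinner H x y) \<le> hnorm H (X i - x) * hnorm H y" for i
      using Cauchy_Schwarz[of "X i - x" y] X x y by simp
  qed
  then show ?thesis by (simp add: LIM_zero_iff)
qed

text \<open>
  Riesz representation, by minimising \<open>\<Phi> g = \<parallel>g\<parallel>\<^sup>2 / 2 - Re (L g)\<close>: the parallelogram law
  makes every minimising sequence a Cauchy sequence, and vanishing of the first variation of
  \<open>\<Phi>\<close> at its limit is the representation formula.
\<close>

theorem Riesz_representation:
  assumes L_add: "\<And>x y. x \<in> hcarrier H \<Longrightarrow> y \<in> hcarrier H \<Longrightarrow> L (x + y) = L x + L y"
    and L_scale: "\<And>c x. x \<in> hcarrier H \<Longrightarrow> L (hscale H c x) = c * L x"
    and L_bound: "\<And>x. x \<in> hcarrier H \<Longrightarrow> cmod (L x) \<le> M * hnorm H x"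
  obtains g where "g \<in> hcarrier H" "\<And>x. x \<in> hcarrier H \<Longrightarrow> hinner H x g = L x"
proof -
  define \<Phi> where "\<Phi> g = (hnorm H g)\<^sup>2 / 2 - Re (L g)" for g
  define m where "m = Inf (\<Phi> ` hcarrier H)"
  have lower: "- (M\<^sup>2 / 2) \<le> \<Phi> x" if "x \<in> hcarrier H" for x
  proof -
    have "Re (L x) \<le> M * hnorm H x"
      using L_bound[OF that] complex_Re_le_cmod[of "L x"] by linarith
    moreover have "0 \<le> (hnorm H x - M)\<^sup>2" by simp
    ultimately show ?thesis by (simp add: \<Phi>_def power2_diff algebra_simps)
  qed
  then have bdd: "bdd_below (\<Phi> ` hcarrier H)" by (auto intro!: bdd_belowI)
  have m_le: "m \<le> \<Phi> x" if "x \<in> hcarrier H" for x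
    unfolding m_def using bdd that by (simp add: cINF_lower)
  have "\<exists>x\<in>hcarrier H. \<Phi> x < m + 1 / (real i + 1)" for i :: nat
  proof (rule ccontr)
    assume "\<not> ?thesis"
    then have "m + 1 / (real i + 1) \<le> Inf (\<Phi> ` hcarrier H)"
      using zero_closed by (intro cINF_greatest) (auto simp: not_less simp del: zero_closed)
    then show False by (simp add: m_def[symmetric])
  qed
  then obtain X where X: "\<And>i. X i \<in> hcarrier H" and X_min: "\<And>i::nat. \<Phi> (X i) < m + 1 / (real i + 1)"
    by metis
  have dist: "(hnorm H (X i - X j))\<^sup>2 \<le> 4 / (real i + 1) + 4 / (real j + 1)" for i j
  proof -
    \<comment> \<open>Parallelogram law: \<open>\<Phi> g + \<Phi> h - 2 \<Phi> ((g + h) / 2) = \<parallel>g - h\<parallel>\<^sup>2 / 4\<close>.\<close>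
    let ?mid = "hscale H (1/2) (X i + X j)"
    have "Re (L ?mid) = (Re (L (X i)) + Re (L (X j))) / 2" using X by (simp add: L_add L_scale)
    moreover have "(hnorm H ?mid)\<^sup>2 = (hnorm H (X i + X j))\<^sup>2 / 4"
      using X by (simp add: power_mult_distrib power2_eq_square)
    ultimately have "(hnorm H (X i - X j))\<^sup>2 = 4 * (\<Phi> (X i) + \<Phi> (X j) - 2 * \<Phi> ?mid)"
      using X by (simp add: \<Phi>_def norm_add_square norm_diff_square del: norm_scale)
    moreover have "m \<le> \<Phi> ?mid" using X by (intro m_le) simp
    ultimately show ?thesis using X_min[of i] X_min[of j] by simp
  qed
  have "\<exists>g\<in>hcarrier H. converges_to X g"
  proof (rule complete)
    show "\<forall>e>0. \<exists>N. \<forall>i\<ge>N. \<forall>j\<ge>N. hnorm H (X i - X j) < e"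
    proof (intro allI impI)
      fix e :: real assume e: "e > 0"
      obtain N where N: "8 / e\<^sup>2 < real N" using reals_Archimedean2 by blast
      have "hnorm H (X i - X j) < e" if "N \<le> i" "N \<le> j" for i j
      proof (rule power2_less_imp_less)
        have small: "4 / (real k + 1) < e\<^sup>2 / 2" if "N \<le> k" for k
        proof -
          have "8 / e\<^sup>2 < real k + 1" using N that by linarith
          then show ?thesis using e by (simp add: field_simps)
        qed
        show "(hnorm H (X i - X j))\<^sup>2 < e\<^sup>2"
          using dist[of i j] small[OF \<open>N \<le> i\<close>] small[OF \<open>N \<le> j\<close>] by linarith
      qed (use e in simp)
      then show "\<exists>N. \<forall>i\<ge>N. \<forall>j\<ge>N. hnorm H (X i - X j) < e" by blast
    qed
  qed (rule X)
  then obtain g where g: "g \<in> hcarrier H" and lim: "converges_to X g" by blast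
  have real_part: "Re (hinner H g x) = Re (L x)" if x: "x \<in> hcarrier H" for x
  proof -
    have inv: "(\<lambda>i. 1 / (real i + 1)) \<longlonglongrightarrow> 0"
      using LIMSEQ_inverse_real_of_nat by (simp add: inverse_eq_divide add.commute)
    have "0 \<le> t * (Re (hinner H g x) - Re (L x)) + t\<^sup>2 * ((hnorm H x)\<^sup>2 / 2) + 0" for t :: real
    \<comment> \<open>Minimality is used for the approximate minimisers \<open>X i\<close>, with error \<open>1 / (i + 1)\<close>, and the
      resulting inequality, linear in \<open>X i\<close>, is passed to the limit.\<close>
    proof (rule tendsto_lowerbound)
      show "(\<lambda>i. t * (Re (hinner H (X i) x) - Re (L x)) + t\<^sup>2 * ((hnorm H x)\<^sup>2 / 2)
               + 1 / (real i + 1))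
          \<longlonglongrightarrow> t * (Re (hinner H g x) - Re (L x)) + t\<^sup>2 * ((hnorm H x)\<^sup>2 / 2) + 0"
        by (intro tendsto_add tendsto_mult tendsto_diff tendsto_Re tendsto_const inv
            converges_to_inner[OF X g x lim])
      show "eventually (\<lambda>i. 0 \<le> t * (Re (hinner H (X i) x) - Re (L x))
              + t\<^sup>2 * ((hnorm H x)\<^sup>2 / 2) + 1 / (real i + 1)) sequentially"
      proof (intro always_eventually allI)
        fix i
        let ?y = "X i + hscale H (of_real t) x"
        have "m \<le> \<Phi> ?y" using X x by (intro m_le) simp
        also have "\<Phi> ?y = \<Phi> (X i) + t * (Re (hinner H (X i) x) - Re (L x)) + t\<^sup>2 * ((hnorm H x)\<^sup>2 / 2)"
          using X[of i] x by (simp add: \<Phi>_def norm_add_square L_add L_scale algebra_simps power_mult_distrib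
              add_divide_distrib)
        finally show "0 \<le> t * (Re (hinner H (X i) x) - Re (L x))
              + t\<^sup>2 * ((hnorm H x)\<^sup>2 / 2) + 1 / (real i + 1)"
          using X_min[of i] by linarith
      qed
    qed simp
    then have "Re (hinner H g x) - Re (L x) = 0"
      by (intro linear_coefficient_zero_of_nonneg_quadratic[where q = "(hnorm H x)\<^sup>2 / 2"]) simp
    then show ?thesis by simp
  qed
  \<comment> \<open>The real part at \<open>\<i> x\<close> supplies the imaginary part at \<open>x\<close>.\<close>
  have "hinner H x g = L x" if x: "x \<in> hcarrier H" for x
    using real_part[OF x] real_part[OF scale_closed[OF x, of \<i>]] inner_cnj[OF g x] x g
    by (simp add: complex_eq_iff L_scale)
  with g show ?thesis using that by blast
qed

end

section \<open>Bounded operators and positive square roots\<close>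

context hilbert_space
begin

lemma bounded_operator_closed:
  "bounded_operator H T \<Longrightarrow> x \<in> hcarrier H \<Longrightarrow> T x \<in> hcarrier H"
  by (simp add: bounded_operator_def)

lemma bounded_operator_add:
  "bounded_operator H T \<Longrightarrow> x \<in> hcarrier H \<Longrightarrow> y \<in> hcarrier H \<Longrightarrow> T (x + y) = T x + T y"
  by (simp add: bounded_operator_def)

lemma bounded_operator_scale:
  "bounded_operator H T \<Longrightarrow> x \<in> hcarrier H \<Longrightarrow> T (hscale H c x) = hscale H c (T x)"
  by (simp add: bounded_operator_def)

lemma bounded_operator_diff:
  assumes "bounded_operator H T" "x \<in> hcarrier H" "y \<in> hcarrier H"
  shows "T (x - y) = T x - T y"
  using bounded_operator_add[OF assms(1), of "x - y" y] assms by simp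

lemma bounded_operator_zero: "bounded_operator H T \<Longrightarrow> T 0 = 0"
  using bounded_operator_diff[of T 0 0] by simp

lemma bounded_operator_sum:
  assumes "bounded_operator H T" "\<And>i. i \<in> I \<Longrightarrow> f i \<in> hcarrier H"
  shows "T (sum f I) = (\<Sum>i\<in>I. T (f i))"
  using assms(2)
  by (induction I rule: infinite_finite_induct)
     (auto simp: bounded_operator_zero[OF assms(1)] bounded_operator_add[OF assms(1)] sum_closed)

lemma converges_to_operator:
  assumes T: "bounded_operator H T" and X: "\<And>i. X i \<in> hcarrier H" and x: "x \<in> hcarrier H"
    and lim: "converges_to X x"
  shows "converges_to (\<lambda>i. T (X i)) (T x)"
proof -
  obtain M where M: "\<And>x. x \<in> hcarrier H \<Longrightarrow> hnorm H (T x) \<le> M * hnorm H x"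
    using T unfolding bounded_operator_def by blast
  have "(\<lambda>i. M * hnorm H (X i - x)) \<longlonglongrightarrow> 0"
    using tendsto_mult_left[OF lim, of M] by simp
  then show ?thesis
  proof (rule Lim_null_comparison[rotated], intro always_eventually allI)
    show "norm (hnorm H (T (X i) - T x)) \<le> M * hnorm H (X i - x)" for i
      using M[of "X i - x"] X[of i] x T
      by (simp add: bounded_operator_diff bounded_operator_closed)
  qed
qed

text \<open>
  A symmetric idempotent is a contraction, because \<open>\<parallel>P x\<parallel>\<^sup>2 = \<langle>P x, x\<rangle> \<le> \<parallel>P x\<parallel> \<parallel>x\<parallel>\<close>; hence
  boundedness follows from the algebraic conditions.
\<close>

lemma orthogonal_projectionI:
  assumes closed: "\<And>x. x \<in> hcarrier H \<Longrightarrow> P x \<in> hcarrier H"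
    and add: "\<And>x y. x \<in> hcarrier H \<Longrightarrow> y \<in> hcarrier H \<Longrightarrow> P (x + y) = P x + P y"
    and scale: "\<And>c x. x \<in> hcarrier H \<Longrightarrow> P (hscale H c x) = hscale H c (P x)"
    and sym: "\<And>x y. x \<in> hcarrier H \<Longrightarrow> y \<in> hcarrier H \<Longrightarrow>
      hinner H (P x) y = hinner H x (P y)"
    and idem: "\<And>x. x \<in> hcarrier H \<Longrightarrow> P (P x) = P x"
  shows "orthogonal_projection H P"
proof -
  have "hnorm H (P x) \<le> 1 * hnorm H x" if x: "x \<in> hcarrier H" for x
  proof (cases "hnorm H (P x) = 0")
    case False
    have "(hnorm H (P x))\<^sup>2 = Re (hinner H x (P x))"
      using x closed idem by (simp add: norm_square sym)
    also have "\<dots> \<le> hnorm H x * hnorm H (P x)"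
      using x closed by (simp add: Re_inner_le)
    finally show ?thesis
      using False norm_nonneg[OF closed[OF x]]
      by (simp add: power2_eq_square del: norm_nonneg)
  qed (use x in simp)
  then show ?thesis
    unfolding orthogonal_projection_def self_adjoint_operator_def bounded_operator_def
    using assms by blast
qed

text \<open>
  A zero of a nonnegative quadratic form is a minimum, so the first variation
  \<open>2 Re \<langle>S x, z\<rangle>\<close> vanishes there in every direction \<open>z\<close>, in particular for \<open>z = S x\<close>.
\<close>

lemma positive_operator_kernel:
  assumes S: "positive_operator H S" and x: "x \<in> hcarrier H" and null: "Re (hinner H (S x) x) = 0"
  shows "S x = 0"
proof -
  have bdd: "bounded_operator H S"
    and sym: "\<And>x y. x \<in> hcarrier H \<Longrightarrow> y \<in> hcarrier H \<Longrightarrow> hinner H (S x) y = hinner H x (S y)"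
    and pos: "\<And>x. x \<in> hcarrier H \<Longrightarrow> 0 \<le> Re (hinner H (S x) x)"
    using S by (auto simp: positive_operator_def self_adjoint_operator_def)
  note simps = bounded_operator_closed[OF bdd] bounded_operator_add[OF bdd] bounded_operator_scale[OF bdd]
  let ?z = "S x"
  have "0 \<le> t * (2 * Re (hinner H ?z ?z)) + t\<^sup>2 * Re (hinner H (S ?z) ?z)" for t :: real
  proof -
    have "0 \<le> Re (hinner H (S (x + hscale H (of_real t) ?z)) (x + hscale H (of_real t) ?z))"
      using x by (intro pos) (simp add: simps)
    also have "\<dots> = t * (2 * Re (hinner H ?z ?z)) + t\<^sup>2 * Re (hinner H (S ?z) ?z)"
      using x null sym[of ?z x] by (simp add: simps algebra_simps power2_eq_square)
    finally show ?thesis .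
  qed
  then have "2 * Re (hinner H ?z ?z) = 0" by (rule linear_coefficient_zero_of_nonneg_quadratic)
  then have "hnorm H ?z = 0" by (simp add: hnorm_def)
  then show ?thesis using x by (simp add: norm_eq_zero simps)
qed

end

text \<open>
  With \<open>A = 1 - T\<close>, the equation \<open>(1 - B)\<^sup>2 = T\<close> reads \<open>B = (A + B\<^sup>2) / 2\<close>. Iterating it from \<open>B = 0\<close>
  converges in norm as soon as \<open>A\<close> is a contraction, because all increments are dominated by those
  of the same iteration for the number \<open>1\<close> in place of \<open>A\<close>, which increases to \<open>1\<close>.
\<close>

primrec majorant :: "nat \<Rightarrow> real" where
  "majorant 0 = 0"
| "majorant (Suc k) = (1 + (majorant k)\<^sup>2) / 2"

primrec fixpoint_iteration :: "'v::ab_group_add ip_space \<Rightarrow> ('v \<Rightarrow> 'v) \<Rightarrow> nat \<Rightarrow> 'v \<Rightarrow> 'v" where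
  "fixpoint_iteration H A 0 = (\<lambda>x. 0)"
| "fixpoint_iteration H A (Suc k) = (\<lambda>x. hscale H (1/2)
     (A x + fixpoint_iteration H A k (fixpoint_iteration H A k x)))"

lemma majorant_bounds: "0 \<le> majorant k" "majorant k \<le> 1"
proof -
  have "0 \<le> majorant k \<and> majorant k \<le> 1"
    by (induction k) (auto intro: power_le_one)
  then show "0 \<le> majorant k" "majorant k \<le> 1" by auto
qed

lemma majorant_Cauchy: "Cauchy majorant"
proof -
  have "majorant k \<le> majorant (Suc k)" for k
    using zero_le_power2[of "1 - majorant k"] by (simp add: power2_diff)
  then show ?thesis
    by (intro convergent_Cauchy Bseq_monoseq_convergent incseq_imp_monoseq incseq_SucI)
       (auto intro!: BseqI'[of _ 1] simp: majorant_bounds)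
qed

context hilbert_space
begin

context
  fixes A :: "'v \<Rightarrow> 'v"
  assumes A: "self_adjoint_operator H A"
    and A_contraction: "\<And>x. x \<in> hcarrier H \<Longrightarrow> hnorm H (A x) \<le> hnorm H x"
begin

abbreviation (input) iter :: "nat \<Rightarrow> 'v \<Rightarrow> 'v" where
  "iter \<equiv> fixpoint_iteration H A"

lemma A_bounded: "bounded_operator H A"
  and A_symmetric: "x \<in> hcarrier H \<Longrightarrow> y \<in> hcarrier H \<Longrightarrow> hinner H (A x) y = hinner H x (A y)"
  using A by (auto simp: self_adjoint_operator_def)

lemma iter_closed [simp]: "x \<in> hcarrier H \<Longrightarrow> iter k x \<in> hcarrier H"
  by (induction k arbitrary: x) (auto simp: bounded_operator_closed[OF A_bounded])

lemma iter_add: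
  "x \<in> hcarrier H \<Longrightarrow> y \<in> hcarrier H \<Longrightarrow> iter k (x + y) = iter k x + iter k y"
  by (induction k arbitrary: x y)
     (auto simp: bounded_operator_add[OF A_bounded] scale_right_distrib add_ac)

lemma iter_scale: "x \<in> hcarrier H \<Longrightarrow> iter k (hscale H c x) = hscale H c (iter k x)"
  by (induction k arbitrary: x)
     (auto simp: bounded_operator_scale[OF A_bounded] scale_right_distrib mult.commute)

lemma iter_diff:
  "x \<in> hcarrier H \<Longrightarrow> y \<in> hcarrier H \<Longrightarrow> iter k (x - y) = iter k x - iter k y"
  using iter_add[of "x - y" y k] by simp

lemma iter_symmetric:
  "x \<in> hcarrier H \<Longrightarrow> y \<in> hcarrier H \<Longrightarrow> hinner H (iter k x) y = hinner H x (iter k y)"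
  by (induction k arbitrary: x y) (auto simp: bounded_operator_closed[OF A_bounded] A_symmetric)

lemma iter_norm: "x \<in> hcarrier H \<Longrightarrow> hnorm H (iter k x) \<le> majorant k * hnorm H x"
proof (induction k arbitrary: x)
  case (Suc k)
  have "hnorm H (iter k (iter k x)) \<le> majorant k * hnorm H (iter k x)"
    using Suc by simp
  also have "\<dots> \<le> majorant k * (majorant k * hnorm H x)"
    using Suc majorant_bounds by (intro mult_left_mono) auto
  finally have "hnorm H (A x + iter k (iter k x)) \<le> hnorm H x + majorant k * (majorant k * hnorm H x)"
    using norm_triangle[of "A x" "iter k (iter k x)"] A_contraction[of x] Suc.prems
    by (simp add: bounded_operator_closed[OF A_bounded])
  then show ?case
    using Suc.prems by (simp add: bounded_operator_closed[OF A_bounded] power2_eq_square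
        add_divide_distrib distrib_right)
qed simp

lemma iter_norm_le: "x \<in> hcarrier H \<Longrightarrow> hnorm H (iter k x) \<le> hnorm H x"
  using iter_norm[of x k] mult_right_mono[OF majorant_bounds(2)[of k], of "hnorm H x"] by simp

text \<open>
  The increments of the operator iteration are dominated by those of the scalar one. This uses
  \<open>C\<^sup>2 - B\<^sup>2 = C (C - B) + (C - B) B\<close> for consecutive iterates \<open>B\<close> and \<open>C\<close>.
\<close>

lemma iter_step:
  "x \<in> hcarrier H \<Longrightarrow>
    hnorm H (iter (Suc k) x - iter k x) \<le> (majorant (Suc k) - majorant k) * hnorm H x"
proof (induction k arbitrary: x)
  case 0
  then show ?case using A_contraction[of x] by (simp add: bounded_operator_closed[OF A_bounded])
next
  case (Suc k)
  let ?B = "iter k" and ?C = "iter (Suc k)" and ?b = "majorant k" and ?c = "majorant (Suc k)"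
  note x = Suc.prems
  have BC: "?B x \<in> hcarrier H" "?C x \<in> hcarrier H" "?B (?B x) \<in> hcarrier H" "?C (?B x) \<in> hcarrier H"
    "?C (?C x) \<in> hcarrier H" using x iter_closed by blast+
  have d: "0 \<le> ?c - ?b"
    using zero_le_power2[of "1 - ?b"] by (simp add: power2_diff)
  have "hnorm H (?C (?C x - ?B x)) \<le> ?c * ((?c - ?b) * hnorm H x)"
    using iter_norm[of "?C x - ?B x" "Suc k"] mult_left_mono[OF Suc.IH[OF x] majorant_bounds(1)[of "Suc k"]]
      BC(1,2) diff_closed order.trans by blast
  moreover have "hnorm H (?C (?B x) - ?B (?B x)) \<le> (?c - ?b) * (?b * hnorm H x)"
    using Suc.IH[OF BC(1)] mult_left_mono[OF iter_norm[OF x, of k] d] by linarith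
  moreover have "?C (?C x) - ?B (?B x) = ?C (?C x - ?B x) + (?C (?B x) - ?B (?B x))"
    using iter_diff[OF BC(2,1), of "Suc k"] by simp
  ultimately have *: "hnorm H (?C (?C x) - ?B (?B x)) \<le> ?c * ((?c - ?b) * hnorm H x) + (?c - ?b) * (?b * hnorm H x)"
    using norm_triangle[of "?C (?C x - ?B x)" "?C (?B x) - ?B (?B x)"] BC
      iter_closed[of "?C x - ?B x" "Suc k"] by (smt (verit) diff_closed)
  have "iter (Suc (Suc k)) x - ?C x = hscale H (1/2) ((A x + ?C (?C x)) - (A x + ?B (?B x)))"
    by (simp only: fixpoint_iteration.simps(2)[of H A "Suc k"] scale_right_diff_distrib)
       (simp only: fixpoint_iteration.simps(2)[of H A k])
  also have "\<dots> = hscale H (1/2) (?C (?C x) - ?B (?B x))" by simp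
  finally have "hnorm H (iter (Suc (Suc k)) x - ?C x) = hnorm H (?C (?C x) - ?B (?B x)) / 2"
    using BC by (simp del: fixpoint_iteration.simps)
  also have "\<dots> \<le> (?c * ((?c - ?b) * hnorm H x) + (?c - ?b) * (?b * hnorm H x)) / 2"
    using * by simp
  also have "\<dots> = ((?c\<^sup>2 - ?b\<^sup>2) / 2) * hnorm H x"
    by (simp add: power2_eq_square algebra_simps del: majorant.simps)
  also have "(?c\<^sup>2 - ?b\<^sup>2) / 2 = majorant (Suc (Suc k)) - ?c"
    by (simp add: diff_divide_distrib add_divide_distrib)
  finally show ?case .
qed

lemma iter_increment:
  assumes x: "x \<in> hcarrier H"
  shows "hnorm H (iter (k + l) x - iter k x) \<le> (majorant (k + l) - majorant k) * hnorm H x"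
proof (induction l)
  case (Suc l)
  show ?case
    using norm_triangle_sub[of "iter (Suc (k + l)) x" "iter (k + l) x" "iter k x"]
      iter_step[OF x, of "k + l"] Suc x iter_closed[OF x, of "Suc (k + l)"]
    by (simp add: algebra_simps del: fixpoint_iteration.simps majorant.simps)
qed simp

lemma iter_convergent:
  assumes x: "x \<in> hcarrier H"
  shows "\<exists>y\<in>hcarrier H. converges_to (\<lambda>k. iter k x) y"
proof (rule complete)
  have bound: "hnorm H (iter i x - iter j x) \<le> \<bar>majorant i - majorant j\<bar> * hnorm H x" for i j
  proof (induction i j rule: linorder_wlog)
    case (le i j)
    have "hnorm H (iter j x - iter i x) \<le> (majorant j - majorant i) * hnorm H x"
      using iter_increment[OF x, of i "j - i"] le by simp
    also have "\<dots> \<le> \<bar>majorant i - majorant j\<bar> * hnorm H x"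
      using x by (intro mult_right_mono) auto
    finally show ?case using x by (simp add: norm_minus_commute)
  next
    case (sym i j)
    then show ?case using x by (simp add: norm_minus_commute abs_minus_commute)
  qed
  show "\<forall>e>0. \<exists>N. \<forall>i\<ge>N. \<forall>j\<ge>N. hnorm H (iter i x - iter j x) < e"
  proof (intro allI impI)
    fix e :: real assume e: "e > 0"
    have pos: "0 < hnorm H x + 1" using norm_nonneg[OF x] by linarith
    then obtain N where N: "\<And>i j. N \<le> i \<Longrightarrow> N \<le> j \<Longrightarrow> \<bar>majorant i - majorant j\<bar> < e / (hnorm H x + 1)"
      using CauchyD[OF majorant_Cauchy, of "e / (hnorm H x + 1)"] e by auto
    have "hnorm H (iter i x - iter j x) < e" if "N \<le> i" "N \<le> j" for i j
    proof -
      have "hnorm H (iter i x - iter j x) \<le> \<bar>majorant i - majorant j\<bar> * (hnorm H x + 1)"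
        using bound[of i j] by (simp add: algebra_simps)
      also have "\<dots> < e" using N[OF that] pos by (simp add: field_simps)
      finally show ?thesis .
    qed
    then show "\<exists>N. \<forall>i\<ge>N. \<forall>j\<ge>N. hnorm H (iter i x - iter j x) < e" by blast
  qed
qed (use x in simp)

text \<open>
  The limit commutes with everything that commutes with \<open>A\<close>. This is recorded because
  uniqueness of the square root depends on it.
\<close>

lemma fixpoint_operator_exists:
  "\<exists>B. self_adjoint_operator H B \<and>
     (\<forall>x\<in>hcarrier H. hnorm H (B x) \<le> hnorm H x) \<and>
     (\<forall>x\<in>hcarrier H. B x = hscale H (1/2) (A x + B (B x))) \<and>
     (\<forall>R. bounded_operator H R \<longrightarrow> (\<forall>x\<in>hcarrier H. R (A x) = A (R x)) \<longrightarrow>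
       (\<forall>x\<in>hcarrier H. R (B x) = B (R x)))"
proof -
  obtain B where B: "\<And>x. x \<in> hcarrier H \<Longrightarrow> B x \<in> hcarrier H"
    and lim: "\<And>x. x \<in> hcarrier H \<Longrightarrow> converges_to (\<lambda>k. iter k x) (B x)"
    using iter_convergent by metis
  have eq_limit: "B x = y"
    if "x \<in> hcarrier H" "y \<in> hcarrier H" "converges_to (\<lambda>k. iter k x) y" for x y
    using that B lim by (intro converges_to_unique[of "\<lambda>k. iter k x"]) auto
  have add_limit: "converges_to (\<lambda>k. X k + Y k) (x + y)"
    if "converges_to X x" "converges_to Y y" "\<And>k. X k \<in> hcarrier H" "\<And>k. Y k \<in> hcarrier H"
      "x \<in> hcarrier H" "y \<in> hcarrier H" for X Y x y
  proof (rule Lim_null_comparison[OF always_eventually], intro allI)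
    show "(\<lambda>k. hnorm H (X k - x) + hnorm H (Y k - y)) \<longlonglongrightarrow> 0"
      using tendsto_add[OF that(1,2)] by simp
    show "norm (hnorm H (X k + Y k - (x + y))) \<le> hnorm H (X k - x) + hnorm H (Y k - y)" for k
      using norm_triangle[of "X k - x" "Y k - y"] that(3-6) by (simp add: add_diff_add)
  qed
  have scale_limit: "converges_to (\<lambda>k. hscale H c (X k)) (hscale H c x)"
    if "converges_to X x" "\<And>k. X k \<in> hcarrier H" "x \<in> hcarrier H" for X x c
    using tendsto_mult_left[OF that(1), of "cmod c"] that(2,3)
    by (simp add: scale_right_diff_distrib[symmetric])
  have add: "B (x + y) = B x + B y" if "x \<in> hcarrier H" "y \<in> hcarrier H" for x y
    using that B lim by (intro eq_limit) (auto simp: iter_add intro!: add_limit)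
  have scale: "B (hscale H c x) = hscale H c (B x)" if "x \<in> hcarrier H" for x c
    using that B lim by (intro eq_limit) (auto simp: iter_scale intro!: scale_limit)
  have norm: "hnorm H (B x) \<le> hnorm H x" if x: "x \<in> hcarrier H" for x
  proof -
    have "hnorm H (B x) \<le> hnorm H x + 0"
    proof (rule tendsto_lowerbound)
      show "(\<lambda>k. hnorm H x + hnorm H (iter k x - B x)) \<longlonglongrightarrow> hnorm H x + 0"
        by (intro tendsto_add tendsto_const lim x)
      show "eventually (\<lambda>k. hnorm H (B x) \<le> hnorm H x + hnorm H (iter k x - B x)) sequentially"
      proof (intro always_eventually allI)
        show "hnorm H (B x) \<le> hnorm H x + hnorm H (iter k x - B x)" for k
          using norm_triangle[of "iter k x" "B x - iter k x"] iter_norm_le[OF x, of k] x B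
          by (simp add: norm_minus_commute)
      qed
    qed simp
    then show ?thesis by simp
  qed
  have bounded: "bounded_operator H B"
    unfolding bounded_operator_def using B add scale norm by (auto intro!: exI[of _ 1])
  have sym: "hinner H (B x) y = hinner H x (B y)" if x: "x \<in> hcarrier H" and y: "y \<in> hcarrier H" for x y
  proof (rule LIMSEQ_unique)
    show "(\<lambda>k. hinner H (iter k x) y) \<longlonglongrightarrow> hinner H (B x) y"
      using x y B lim by (intro converges_to_inner) auto
    have "(\<lambda>k. cnj (hinner H (iter k y) x)) \<longlonglongrightarrow> cnj (hinner H (B y) x)"
      using x y B lim by (intro tendsto_cnj converges_to_inner) auto
    then show "(\<lambda>k. hinner H (iter k x) y) \<longlonglongrightarrow> hinner H x (B y)"
      using x y B by (simp add: iter_symmetric inner_cnj[of _ x])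
  qed
  have fixpoint: "B x = hscale H (1/2) (A x + B (B x))" if x: "x \<in> hcarrier H" for x
  proof -
    \<comment> \<open>Squares converge because the iterates are uniformly contractive:
      \<open>B\<^sub>k B\<^sub>k x - B B x = B\<^sub>k (B\<^sub>k x - B x) + (B\<^sub>k - B) B x\<close>.\<close>
    have square: "converges_to (\<lambda>k. iter k (iter k x)) (B (B x))"
    proof (rule Lim_null_comparison[OF always_eventually], intro allI)
      show "(\<lambda>k. hnorm H (iter k x - B x) + hnorm H (iter k (B x) - B (B x))) \<longlonglongrightarrow> 0"
        using tendsto_add[OF lim[OF x] lim[OF B[OF x]]] by simp
      show "norm (hnorm H (iter k (iter k x) - B (B x)))
          \<le> hnorm H (iter k x - B x) + hnorm H (iter k (B x) - B (B x))" for k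
        using norm_triangle_sub[of "iter k (iter k x)" "iter k (B x)" "B (B x)"]
          iter_norm_le[of "iter k x - B x" k] x B by (simp add: iter_diff)
    qed
    have "converges_to (\<lambda>k. A x) (A x)" by simp
    then have "converges_to (\<lambda>k. A x + iter k (iter k x)) (A x + B (B x))"
      using x B by (intro add_limit[OF _ square]) (auto simp: bounded_operator_closed[OF A_bounded])
    then have "converges_to (\<lambda>k. iter (Suc k) x) (hscale H (1/2) (A x + B (B x)))"
      unfolding fixpoint_iteration.simps
      using x B by (intro scale_limit) (auto simp: bounded_operator_closed[OF A_bounded])
    then have "converges_to (\<lambda>k. iter k x) (hscale H (1/2) (A x + B (B x)))"
      by (rule LIMSEQ_imp_Suc)
    then show ?thesis using x B by (intro eq_limit) (auto simp: bounded_operator_closed[OF A_bounded])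
  qed
  have commute: "R (B x) = B (R x)"
    if R: "bounded_operator H R" and comm: "\<And>x. x \<in> hcarrier H \<Longrightarrow> R (A x) = A (R x)"
      and x: "x \<in> hcarrier H" for R x
  proof -
    have "R (iter k x) = iter k (R x)" if "x \<in> hcarrier H" for k x
      using that
    proof (induction k arbitrary: x)
      case (Suc k)
      then show ?case
        by (simp add: bounded_operator_scale[OF R] bounded_operator_add[OF R] comm
            bounded_operator_closed[OF A_bounded] bounded_operator_closed[OF R])
    qed (simp add: bounded_operator_zero[OF R])
    then have "converges_to (\<lambda>k. iter k (R x)) (R (B x))"
      using converges_to_operator[OF R _ _ lim[OF x]] x B by simp
    then show ?thesis
      using eq_limit[of "R x" "R (B x)"] x B by (simp add: bounded_operator_closed[OF R])
  qed
  show ?thesis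
  proof (intro exI[of _ B] conjI allI impI ballI)
    show "self_adjoint_operator H B" using bounded sym by (simp add: self_adjoint_operator_def)
  qed (blast intro: norm fixpoint commute)+
qed

end

text \<open>
  The hypothesis \<open>\<parallel>x - T x\<parallel> \<le> \<parallel>x\<parallel>\<close> covers the positive contractions and makes the iteration for
  \<open>A = 1 - T\<close> applicable. Any other positive root \<open>R\<close> commutes with \<open>T = R\<^sup>2\<close>, hence with the root \<open>S\<close> obtained by
  iteration. For \<open>y = (S - R) x\<close> this gives \<open>\<langle>S y, y\<rangle> + \<langle>R y, y\<rangle> = \<langle>(S\<^sup>2 - R\<^sup>2) x, y\<rangle> = 0\<close>, so that
  \<open>S y = R y = 0\<close> and \<open>\<parallel>y\<parallel>\<^sup>2 = \<langle>(S - R) y, x\<rangle> = 0\<close>.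
\<close>

theorem operator_sqrt:
  assumes T: "self_adjoint_operator H T"
    and T_contraction: "\<And>x. x \<in> hcarrier H \<Longrightarrow> hnorm H (x - T x) \<le> hnorm H x"
  shows "positive_operator H (operator_sqrt H T)"
    and "x \<in> hcarrier H \<Longrightarrow> operator_sqrt H T (operator_sqrt H T x) = T x"
proof -
  define A where "A x = x - T x" for x
  have T_bounded: "bounded_operator H T"
    and T_symmetric: "\<And>x y. x \<in> hcarrier H \<Longrightarrow> y \<in> hcarrier H \<Longrightarrow> hinner H (T x) y = hinner H x (T y)"
    using T by (auto simp: self_adjoint_operator_def)
  note T_closed = bounded_operator_closed[OF T_bounded]
  have A_contraction: "hnorm H (A x) \<le> hnorm H x" if "x \<in> hcarrier H" for x
    using T_contraction that by (simp add: A_def)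
  have "self_adjoint_operator H A"
    unfolding self_adjoint_operator_def bounded_operator_def
  proof (intro conjI ballI allI exI[of _ 1])
    show "hnorm H (A x) \<le> 1 * hnorm H x" if "x \<in> hcarrier H" for x using A_contraction that by simp
  qed (simp_all add: A_def T_closed T_symmetric bounded_operator_add[OF T_bounded] bounded_operator_scale[OF T_bounded]
      scale_right_diff_distrib)
  from fixpoint_operator_exists[OF this A_contraction] obtain B where
    B: "self_adjoint_operator H B" and B_norm: "\<And>x. x \<in> hcarrier H \<Longrightarrow> hnorm H (B x) \<le> hnorm H x"
    and B_fix: "\<And>x. x \<in> hcarrier H \<Longrightarrow> B x = hscale H (1/2) (A x + B (B x))"
    and B_commute: "\<And>R x. bounded_operator H R \<Longrightarrow> \<forall>x\<in>hcarrier H. R (A x) = A (R x) \<Longrightarrow>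
      x \<in> hcarrier H \<Longrightarrow> R (B x) = B (R x)" by blast
  have B_bounded: "bounded_operator H B"
    and B_symmetric: "\<And>x y. x \<in> hcarrier H \<Longrightarrow> y \<in> hcarrier H \<Longrightarrow> hinner H (B x) y = hinner H x (B y)"
    using B by (auto simp: self_adjoint_operator_def)
  note B_closed = bounded_operator_closed[OF B_bounded]
  \<comment> \<open>The restriction makes \<open>S\<close> extensional, as \<open>operator_sqrt\<close> demands of its value.\<close>
  define S where "S = restrict (\<lambda>x. x - B x) (hcarrier H)"
  have S_eq: "S x = x - B x" if "x \<in> hcarrier H" for x using that by (simp add: S_def)
  have S_bounded: "bounded_operator H S"
    unfolding bounded_operator_def
  proof (intro conjI ballI allI exI[of _ 2])
    show "hnorm H (S x) \<le> 2 * hnorm H x" if x: "x \<in> hcarrier H" for x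
      using norm_triangle_sub[of x 0 "B x"] norm_minus_commute[of 0 "B x"] B_norm[OF x] x
      by (simp add: S_eq B_closed)
  qed (simp_all add: S_eq B_closed bounded_operator_add[OF B_bounded] bounded_operator_scale[OF B_bounded]
      scale_right_diff_distrib)
  note S_closed = bounded_operator_closed[OF S_bounded]
  have S_symmetric: "hinner H (S x) y = hinner H x (S y)" if "x \<in> hcarrier H" "y \<in> hcarrier H" for x y
    using that by (simp add: S_eq B_closed B_symmetric)
  have S_positive: "0 \<le> Re (hinner H (S x) x)" if x: "x \<in> hcarrier H" for x
    using Re_inner_le[of "B x" x] mult_right_mono[OF B_norm[OF x], of "hnorm H x"] x
    by (simp add: S_eq B_closed power2_eq_square flip: norm_square)
  have S: "positive_operator H S"
    using S_bounded S_symmetric S_positive by (simp add: positive_operator_def self_adjoint_operator_def)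
  have S_square: "S (S x) = T x" if x: "x \<in> hcarrier H" for x
  proof -
    have "B x + B x = hscale H 2 (B x)" using scale_left_distrib[of 1 1 "B x"] by simp
    also have "\<dots> = A x + B (B x)" by (subst B_fix[OF x]) simp
    finally show ?thesis
      using x by (simp add: S_eq B_closed bounded_operator_diff[OF B_bounded] A_def algebra_simps)
  qed
  have unique: "R = S"
    if R: "positive_operator H R" and R_square: "\<forall>x\<in>hcarrier H. R (R x) = T x"
      and R_ext: "R \<in> extensional (hcarrier H)" for R
  proof (rule extensionalityI[OF R_ext])
    show "S \<in> extensional (hcarrier H)" by (simp add: S_def)
    have R_bounded: "bounded_operator H R"
      and R_symmetric: "\<And>x y. x \<in> hcarrier H \<Longrightarrow> y \<in> hcarrier H \<Longrightarrow> hinner H (R x) y = hinner H x (R y)"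
      and R_positive: "\<And>x. x \<in> hcarrier H \<Longrightarrow> 0 \<le> Re (hinner H (R x) x)"
      using R by (auto simp: positive_operator_def self_adjoint_operator_def)
    note R_closed = bounded_operator_closed[OF R_bounded]
    have RT: "R (T x) = T (R x)" if "x \<in> hcarrier H" for x
      using R_square R_closed that by metis
    have "R (A x) = A (R x)" if "x \<in> hcarrier H" for x
      using that by (simp add: A_def bounded_operator_diff[OF R_bounded] T_closed RT)
    then have "\<forall>x\<in>hcarrier H. R (A x) = A (R x)" by blast
    then have RS: "R (S x) = S (R x)" if "x \<in> hcarrier H" for x
      using that B_commute[OF R_bounded, of x]
      by (simp add: S_eq R_closed B_closed bounded_operator_diff[OF R_bounded])
    fix x assume x: "x \<in> hcarrier H"
    define y where "y = S x - R x"
    have y: "y \<in> hcarrier H" using x by (simp add: y_def S_closed R_closed)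
    have "S y + R y = 0"
      using x by (simp add: y_def bounded_operator_diff[OF S_bounded] bounded_operator_diff[OF R_bounded]
          S_closed R_closed S_square R_square RS)
    then have "hinner H (S y) y + hinner H (R y) y = 0"
      using y by (simp add: S_closed R_closed flip: inner_add_left)
    then have "Re (hinner H (S y) y) + Re (hinner H (R y) y) = 0" by (metis plus_complex.sel(1) zero_complex.sel(1))
    then have "Re (hinner H (S y) y) = 0" "Re (hinner H (R y) y) = 0"
      using S_positive[OF y] R_positive[OF y] by linarith+
    then have "S y = 0" "R y = 0"
      using positive_operator_kernel S R y by blast+
    then have "hinner H x (S y) - hinner H x (R y) = 0" using x by simp
    then have "hinner H y y = 0"
      using x y by (simp add: y_def[symmetric] S_symmetric[symmetric] R_symmetric[symmetric]
          S_closed R_closed flip: inner_diff_left)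
    then have "y = 0" using inner_pos[OF y] by force
    then show "R x = S x" by (simp add: y_def)
  qed
  have "operator_sqrt H T = S"
    unfolding operator_sqrt_def
  proof (rule the_equality)
    show "positive_operator H S \<and> (\<forall>x\<in>hcarrier H. S (S x) = T x) \<and> S \<in> extensional (hcarrier H)"
      using S S_square by (simp add: S_def)
  qed (use unique in blast)
  then show "positive_operator H (operator_sqrt H T)"
    and "x \<in> hcarrier H \<Longrightarrow> operator_sqrt H T (operator_sqrt H T x) = T x"
    using S S_square by simp_all
qed

end

section \<open>Finite powers and projections in generic position\<close>

lemma hilbert_power_simps [simp]:
  "f \<in> hcarrier (hilbert_power H n) \<longleftrightarrow>
    (\<forall>k\<in>{1..n}. f k \<in> hcarrier H) \<and> (\<forall>k. k \<notin> {1..n} \<longrightarrow> f k = 0)"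
  "hscale (hilbert_power H n) c f = (\<lambda>k. hscale H c (f k))"
  "hinner (hilbert_power H n) f g = (\<Sum>k=1..n. hinner H (f k) (g k))"
  by (simp_all add: hilbert_power_def)

lemma hilbert_space_power:
  assumes "hilbert_space H" shows "hilbert_space (hilbert_power H n)"
proof -
  interpret hilbert_space H by fact
  let ?K = "hilbert_power H n"
  have vs: "vector_space (hscale ?K)"
    by unfold_locales (auto simp: fun_eq_iff scale_right_distrib scale_left_distrib)
  have norm: "hnorm ?K f = sqrt (\<Sum>k=1..n. (hnorm H (f k))\<^sup>2)" if "f \<in> hcarrier ?K" for f
    using that unfolding hnorm_def[of ?K] by (auto simp: norm_square intro!: sum.cong)
  show ?thesis
  proof (intro hilbert_space.intro hilbert_space_axioms.intro)
    show "vector_space (hscale ?K)" by (rule vs)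
    interpret K: vector_space "hscale ?K" by (rule vs)
    show "K.subspace (hcarrier ?K)" by (auto simp: K.subspace_def)
    show "hinner ?K (x + y) z = hinner ?K x z + hinner ?K y z"
      if "x \<in> hcarrier ?K" "y \<in> hcarrier ?K" "z \<in> hcarrier ?K" for x y z
      using that by (simp add: sum.distrib)
    show "hinner ?K (hscale ?K c x) y = c * hinner ?K x y"
      if "x \<in> hcarrier ?K" "y \<in> hcarrier ?K" for c x y
      using that by (simp add: sum_distrib_left)
    show "hinner ?K y x = cnj (hinner ?K x y)"
      if "x \<in> hcarrier ?K" "y \<in> hcarrier ?K" for x y
      unfolding hilbert_power_simps(3) cnj_sum using that by (intro sum.cong refl inner_cnj) auto
    show "0 < Re (hinner ?K x x)" if x: "x \<in> hcarrier ?K" and "x \<noteq> 0" for x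
    proof -
      obtain k where "x k \<noteq> 0" using \<open>x \<noteq> 0\<close> by (auto simp: fun_eq_iff)
      moreover from this have "k \<in> {1..n}" using x by auto
      ultimately show ?thesis
        using x inner_pos[of "x k"] by (auto intro!: sum_pos2[of _ k] inner_self_nonneg)
    qed
    show "\<exists>x\<in>hcarrier ?K. (\<lambda>i. hnorm ?K (X i - x)) \<longlonglongrightarrow> 0"
      if X: "\<And>i::nat. X i \<in> hcarrier ?K"
        and Cauchy: "\<forall>e>0. \<exists>N. \<forall>i\<ge>N. \<forall>j\<ge>N. hnorm ?K (X i - X j) < e" for X
    proof -
      have component: "hnorm H (f k) \<le> hnorm ?K f" if f: "f \<in> hcarrier ?K" and k: "k \<in> {1..n}" for f k
      proof -
        have "(hnorm H (f k))\<^sup>2 \<le> (\<Sum>k=1..n. (hnorm H (f k))\<^sup>2)"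
          using k by (intro member_le_sum) auto
        then show ?thesis using f k by (simp add: norm real_le_rsqrt del: hilbert_power_simps)
      qed
      have "\<exists>y\<in>hcarrier H. (\<lambda>i. hnorm H (X i k - y)) \<longlonglongrightarrow> 0" if k: "k \<in> {1..n}" for k
      proof (rule complete)
        show "X i k \<in> hcarrier H" for i using X[of i] k by simp
        show "\<forall>e>0. \<exists>N. \<forall>i\<ge>N. \<forall>j\<ge>N. hnorm H (X i k - X j k) < e"
        proof (intro allI impI)
          fix e :: real assume "e > 0"
          then obtain N where N: "\<And>i j. N \<le> i \<Longrightarrow> N \<le> j \<Longrightarrow> hnorm ?K (X i - X j) < e"
            using Cauchy by blast
          have "hnorm H (X i k - X j k) < e" if "N \<le> i" "N \<le> j" for i j
            using component[of "X i - X j" k] N[OF that] X[of i] X[of j] k by simp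
          then show "\<exists>N. \<forall>i\<ge>N. \<forall>j\<ge>N. hnorm H (X i k - X j k) < e" by blast
        qed
      qed
      then obtain y where y: "\<And>k. k \<in> {1..n} \<Longrightarrow> y k \<in> hcarrier H"
        and lim: "\<And>k. k \<in> {1..n} \<Longrightarrow> (\<lambda>i. hnorm H (X i k - y k)) \<longlonglongrightarrow> 0" by metis
      define x where "x k = (if k \<in> {1..n} then y k else 0)" for k
      have x: "x \<in> hcarrier ?K" using y by (simp add: x_def)
      have "(\<lambda>i. sqrt (\<Sum>k=1..n. (hnorm H (X i k - x k))\<^sup>2)) \<longlonglongrightarrow> sqrt (\<Sum>k=1..n. 0\<^sup>2)"
        using lim by (intro tendsto_real_sqrt tendsto_sum tendsto_power) (auto simp: x_def)
      moreover have "hnorm ?K (X i - x) = sqrt (\<Sum>k=1..n. (hnorm H (X i k - x k))\<^sup>2)" for i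
        using X[of i] x by (subst norm) auto
      ultimately show ?thesis using x by (intro bexI[of _ x]) simp_all
    qed
  qed
qed

text \<open>
  Write \<open>V g = (S\<^sub>1 g, \<dots>, S\<^sub>n g)\<close>. The hypothesis \<open>\<Sum>\<^sub>k S\<^sub>k\<^sup>2 = 1\<close> says that \<open>V\<close> is an isometry, and
  the operator below is \<open>V V\<^sup>*\<close>, the projection onto the range of \<open>V\<close>. A vector supported in
  position \<open>j\<close> is orthogonal to that range iff its entry is in the kernel of \<open>S\<^sub>j\<close>, and \<open>V g\<close> is
  orthogonal to all such vectors iff \<open>S\<^sub>j g = 0\<close>; so injectivity of the \<open>S\<^sub>j\<close> is generic position.
\<close>

theorem all_but_one_generic_position_of_resolution:
  fixes H :: "(complex \<Rightarrow> complex) ip_space" and n :: nat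
  assumes H: "hilbert_space H"
    and S: "\<And>k. k \<in> {1..n} \<Longrightarrow> self_adjoint_operator H (S k)"
    and injective: "\<And>k x. k \<in> {1..n} \<Longrightarrow> x \<in> hcarrier H \<Longrightarrow> S k x = 0 \<Longrightarrow> x = 0"
    and resolution: "\<And>x. x \<in> hcarrier H \<Longrightarrow> (\<Sum>k=1..n. S k (S k x)) = x"
  shows "all_but_one_generic_position (hilbert_power H n) n
    (\<lambda>f j. if j \<in> {1..n} then \<Sum>k=1..n. S j (S k (f k)) else 0) Q_Pi"
    (is "all_but_one_generic_position ?K n ?P Q_Pi")
proof -
  interpret hilbert_space H by fact
  interpret K: hilbert_space ?K by (rule hilbert_space_power[OF H])
  have bounded: "\<And>k. k \<in> {1..n} \<Longrightarrow> bounded_operator H (S k)"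
    and symmetric: "\<And>k x y. k \<in> {1..n} \<Longrightarrow> x \<in> hcarrier H \<Longrightarrow> y \<in> hcarrier H \<Longrightarrow>
      hinner H (S k x) y = hinner H x (S k y)"
    using S by (auto simp: self_adjoint_operator_def)
  note closed [simp] = bounded_operator_closed[OF bounded]
  note lin = bounded_operator_add[OF bounded] bounded_operator_scale[OF bounded]
  define V where "V g = (\<lambda>j. if j \<in> {1..n} then S j g else 0)" for g
  \<comment> \<open>\<open>W\<close> is the adjoint of \<open>V\<close>.\<close>
  define W where "W f = (\<Sum>k=1..n. S k (f k))" for f
  have W_closed [simp]: "W f \<in> hcarrier H" if "f \<in> hcarrier ?K" for f
    unfolding W_def using that by (intro sum_closed) simp
  have V_closed [simp]: "V g \<in> hcarrier ?K" if "g \<in> hcarrier H" for g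
    using that by (simp add: V_def)
  define P where "P = ?P"
  have P_eq: "P f = V (W f)" if "f \<in> hcarrier ?K" for f
  proof (rule ext)
    fix j
    show "P f j = V (W f) j"
      using that bounded_operator_sum[OF bounded[of j], of "{1..n}" "\<lambda>k. S k (f k)"]
      by (simp add: P_def V_def W_def)
  qed
  have adjoint: "hinner ?K (V g) f = hinner H g (W f)" if "f \<in> hcarrier ?K" "g \<in> hcarrier H" for f g
    using that inner_sum_right[of "{1..n}" "\<lambda>k. S k (f k)" g] by (simp add: V_def W_def symmetric)
  have WV: "W (V g) = g" if "g \<in> hcarrier H" for g
    using resolution[OF that] by (simp add: W_def V_def)
  have V_inner: "hinner ?K (V g) (V h) = hinner H g h" if "g \<in> hcarrier H" "h \<in> hcarrier H" for g h
    using that adjoint[OF V_closed[OF that(2)] that(1)] WV[OF that(2)] by simp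
  have P: "orthogonal_projection ?K P"
  proof (rule K.orthogonal_projectionI)
    show "P f \<in> hcarrier ?K" if "f \<in> hcarrier ?K" for f
      unfolding P_eq[OF that] using that by (intro V_closed W_closed)
    show "P (f + g) = P f + P g" if "f \<in> hcarrier ?K" "g \<in> hcarrier ?K" for f g
      using that by (auto simp: P_def fun_eq_iff lin sum.distrib)
    show "P (hscale ?K c f) = hscale ?K c (P f)" if "f \<in> hcarrier ?K" for c f
      using that by (auto simp: P_def fun_eq_iff lin scale_sum_right)
    show "P (P f) = P f" if f: "f \<in> hcarrier ?K" for f
      unfolding P_eq[OF f] P_eq[OF V_closed[OF W_closed[OF f]]] WV[OF W_closed[OF f]] ..
    show "hinner ?K (P f) g = hinner ?K f (P g)" if f: "f \<in> hcarrier ?K" and g: "g \<in> hcarrier ?K" for f g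
      unfolding P_eq[OF f] P_eq[OF g] K.inner_cnj[OF V_closed[OF W_closed[OF g]] f]
        adjoint[OF g W_closed[OF f]] adjoint[OF f W_closed[OF g]]
      by (rule inner_cnj[OF W_closed[OF g] W_closed[OF f]])
  qed
  have Q: "orthogonal_projection ?K (Q_Pi j)" if j: "j \<in> {1..n}" for j
  proof (rule K.orthogonal_projectionI)
    show "hinner ?K (Q_Pi j f) g = hinner ?K f (Q_Pi j g)" if "f \<in> hcarrier ?K" "g \<in> hcarrier ?K" for f g
      using that by (auto simp: Q_Pi_def intro!: sum.cong)
  qed (use j in \<open>auto simp: Q_Pi_def fun_eq_iff\<close>)
  have Q_inner: "hinner ?K x (Q_Pi j y) = hinner H (x j) (y j)"
    if "j \<in> {1..n}" "x \<in> hcarrier ?K" "y \<in> hcarrier ?K" for x y j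
  proof -
    have "hinner ?K x (Q_Pi j y) = (\<Sum>k=1..n. if k = j then hinner H (x j) (y j) else 0)"
      unfolding hilbert_power_simps(3) using that(2) by (intro sum.cong) (auto simp: Q_Pi_def)
    then show ?thesis using that by (simp add: sum.delta del: hilbert_power_simps)
  qed
  have "ortho_complement ?K (P ` hcarrier ?K) \<inter> Q_Pi j ` hcarrier ?K = {0}"
    and "P ` hcarrier ?K \<inter> ortho_complement ?K (Q_Pi j ` hcarrier ?K) = {0}" if j: "j \<in> {1..n}" for j
  proof -
    have V0: "V 0 = 0"
      by (rule ext) (simp add: V_def bounded_operator_zero[OF bounded])
    have "W 0 = 0"
      unfolding W_def by (rule sum.neutral) (simp add: bounded_operator_zero[OF bounded])
    then have P0: "P 0 = 0" using P_eq[OF K.zero_closed] V0 by simp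
    have Q0: "Q_Pi j 0 = 0" by (rule ext) (simp add: Q_Pi_def)
    have "f = 0" if orth: "f \<in> ortho_complement ?K (P ` hcarrier ?K)" and range: "f \<in> Q_Pi j ` hcarrier ?K" for f
    proof -
      obtain h where h: "h \<in> hcarrier ?K" and f_eq: "f = Q_Pi j h" using range by blast
      have f: "f \<in> hcarrier ?K" using orth by (simp add: ortho_complement_def del: hilbert_power_simps)
      have hj: "h j \<in> hcarrier H" using h j by simp
      have Wf: "W f = S j (h j)"
      proof -
        have "W f = (\<Sum>k=1..n. if k = j then S j (h j) else 0)"
          unfolding W_def f_eq by (intro sum.cong) (auto simp: Q_Pi_def bounded_operator_zero[OF bounded])
        then show ?thesis using j by simp
      qed
      have "hinner ?K f (P f) = 0" using orth f by (simp add: ortho_complement_def del: hilbert_power_simps)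
      then have "hinner ?K f (V (W f)) = 0" unfolding P_eq[OF f] .
      then have "hinner ?K (V (W f)) f = 0"
        using K.inner_cnj[OF f V_closed[OF W_closed[OF f]]] by simp
      then have "hinner H (W f) (W f) = 0" using adjoint[OF f W_closed[OF f]] by simp
      then have "W f = 0" using inner_pos[OF W_closed[OF f]] by force
      then have "h j = 0" using injective[OF j hj] Wf by simp
      then show "f = 0" by (auto simp: f_eq Q_Pi_def fun_eq_iff)
    qed
    moreover have "f = 0" if range: "f \<in> P ` hcarrier ?K"
      and orth: "f \<in> ortho_complement ?K (Q_Pi j ` hcarrier ?K)" for f
    proof -
      obtain h where h: "h \<in> hcarrier ?K" and f_eq: "f = V (W h)" using range P_eq by auto
      have f: "f \<in> hcarrier ?K" using orth by (simp add: ortho_complement_def del: hilbert_power_simps)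
      have "hinner ?K f (Q_Pi j f) = 0" using orth f by (simp add: ortho_complement_def del: hilbert_power_simps)
      then have "hinner H (f j) (f j) = 0" using Q_inner[OF j f f] by simp
      then have "f j = 0" using inner_pos[of "f j"] f j by force
      then have "S j (W h) = 0" using j by (simp add: f_eq V_def)
      then have "W h = 0" using injective j W_closed[OF h] by blast
      then show "f = 0" using V0 by (simp add: f_eq)
    qed
    moreover have "0 \<in> P ` hcarrier ?K" "0 \<in> Q_Pi j ` hcarrier ?K"
      using P0 Q0 K.zero_closed by (metis image_eqI)+
    moreover have "0 \<in> ortho_complement ?K X" if "X \<subseteq> hcarrier ?K" for X
      using that by (auto simp: ortho_complement_def simp del: hilbert_power_simps)
    moreover have "P ` hcarrier ?K \<subseteq> hcarrier ?K" "Q_Pi j ` hcarrier ?K \<subseteq> hcarrier ?K"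
      using P Q[OF j] by (auto simp: orthogonal_projection_def self_adjoint_operator_def bounded_operator_def
          simp del: hilbert_power_simps)
    ultimately show "ortho_complement ?K (P ` hcarrier ?K) \<inter> Q_Pi j ` hcarrier ?K = {0}"
      and "P ` hcarrier ?K \<inter> ortho_complement ?K (Q_Pi j ` hcarrier ?K) = {0}"
      by blast+
  qed
  then show ?thesis
    unfolding all_but_one_generic_position_def P_def[symmetric] using P Q K.hilbert_space_axioms by blast
qed

section \<open>Area estimates for holomorphic functions\<close>

text \<open>
  In Cauchy's formula for a circle of radius \<open>r\<close>, the kernel \<open>r / |z - w|\<close> is at most \<open>2\<close>
  when \<open>w\<close> lies within \<open>r / 2\<close> of the centre.
\<close>

lemma cmod_le_circle_average:
  assumes holo: "f holomorphic_on cball c r" and w: "dist c w \<le> r / 2" and r: "0 < r"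
    and [measurable]: "f \<in> borel_measurable borel"
  shows "ennreal (cmod (f w)) \<le> 2 * (\<integral>\<^sup>+t. ennreal (cmod (f (circlepath c r t))) * indicator {0..1} t \<partial>lborel)"
proof -
  define g where "g t = cmod (f (circlepath c r t))" for t
  have "dist (circlepath c r t) c = r" for t
    using r by (simp add: circlepath dist_norm norm_mult)
  then have on_circle: "circlepath c r t \<in> cball c r" and far: "r / 2 \<le> cmod (circlepath c r t - w)" for t
    using dist_triangle[of "circlepath c r t" c w] w by (auto simp: dist_norm norm_minus_commute)
  have "continuous_on {0..1} g"
    unfolding g_def using on_circle
    by (intro continuous_on_norm continuous_on_compose2[OF holomorphic_on_imp_continuous_on[OF holo]])
       (auto simp: circlepath intro!: continuous_intros)
  then have int: "(g has_integral integral {0..1} g) {0..1}"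
    by (intro integrable_integral integrable_continuous_real)
  have "((\<lambda>u. f u / (u - w)) has_contour_integral (2 * of_real pi * \<i> * f w)) (circlepath c r)"
    using holo w r by (intro Cauchy_integral_circlepath_simple) (auto simp: dist_norm norm_minus_commute)
  then have "norm (2 * of_real pi * \<i> * f w) \<le> inner (4 * pi * integral {0..1} g) 1"
    unfolding has_contour_integral_def
  proof (rule has_integral_norm_bound_integral_component[OF _ has_integral_mult_right[OF int, of "4 * pi"]])
    fix t :: real assume t: "t \<in> {0..1}"
    let ?z = "circlepath c r t"
    have "norm (f ?z / (?z - w) * vector_derivative (circlepath c r) (at t within {0..1})) =
        g t * (2 * pi * r) / cmod (?z - w)"
      using t r by (simp add: vector_derivative_circlepath01 norm_mult norm_divide g_def)
    also have "\<dots> \<le> g t * (2 * pi * r) / (r / 2)"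
      using far[of t] r by (intro divide_left_mono mult_pos_pos) (auto simp: g_def)
    finally show "norm (f ?z / (?z - w) * vector_derivative (circlepath c r) (at t within {0..1}))
        \<le> inner (4 * pi * g t) 1"
      using r by (simp add: mult_ac)
  qed
  then have "cmod (f w) \<le> 2 * integral {0..1} g" by (simp add: norm_mult)
  then have "ennreal (cmod (f w)) \<le> 2 * ennreal (integral {0..1} g)"
    by (metis ennreal_leI ennreal_mult' ennreal_numeral zero_le_numeral)
  also have "ennreal (integral {0..1} g) = (\<integral>\<^sup>+t. ennreal (g t) * indicator {0..1} t \<partial>lborel)"
    by (rule nn_integral_has_integral_lebesgue'[OF _ int, symmetric]) (simp add: g_def)
  finally show ?thesis by (simp add: g_def)
qed

text \<open>
  The circle averages bound \<open>|f w|\<close> for every centre \<open>c\<close> close to \<open>w\<close>. Averaging over \<open>c\<close> as well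
  turns them into area integrals by translation invariance of Lebesgue measure.
\<close>

lemma cmod_le_area_integral:
  assumes holo: "f holomorphic_on ball w (2 * r)" and r: "0 < r"
    and [measurable]: "f \<in> borel_measurable borel"
  shows "ennreal (cmod (f w) * measure lborel (ball w (r / 2))) \<le>
    2 * (\<integral>\<^sup>+z. ennreal (cmod (f z)) * indicator (ball w (2 * r)) z \<partial>lborel)"
proof -
  have [measurable]: "ball w s \<in> sets borel" for s by simp
  have [measurable]: "(\<lambda>p. circlepath (fst p) r (snd p)) \<in> borel_measurable (lborel \<Otimes>\<^sub>M lborel)"
    unfolding circlepath by measurable
  define G where "G c t = ennreal (cmod (f (circlepath c r t))) * indicator {0..1} t * indicator (ball w (r / 2)) c"
    for c t
  have [measurable]: "case_prod G \<in> borel_measurable (lborel \<Otimes>\<^sub>M lborel)"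
    unfolding G_def case_prod_unfold by measurable
  have "ennreal (cmod (f w) * measure lborel (ball w (r / 2)))
      = (\<integral>\<^sup>+c. ennreal (cmod (f w)) * indicator (ball w (r / 2)) c \<partial>lborel)"
    using emeasure_lborel_ball_finite[of w "r / 2"]
    by (simp add: nn_integral_cmult_indicator ennreal_mult emeasure_eq_ennreal_measure)
  also have "\<dots> \<le> (\<integral>\<^sup>+c. 2 * (\<integral>\<^sup>+t. G c t \<partial>lborel) \<partial>lborel)"
  proof (intro nn_integral_mono)
    fix c
    show "ennreal (cmod (f w)) * indicator (ball w (r / 2)) c \<le> 2 * (\<integral>\<^sup>+t. G c t \<partial>lborel)"
    proof (cases "c \<in> ball w (r / 2)")
      case True
      then have near: "dist w c < r / 2" by simp
      have "cball c r \<subseteq> ball w (2 * r)"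
      proof
        fix z assume "z \<in> cball c r"
        then show "z \<in> ball w (2 * r)" using near dist_triangle[of w z c] r by simp
      qed
      then show ?thesis
        using cmod_le_circle_average[of f c r w] near r holo holomorphic_on_subset True
        by (auto simp: G_def dist_commute)
    qed simp
  qed
  also have "\<dots> = 2 * (\<integral>\<^sup>+c. (\<integral>\<^sup>+t. G c t \<partial>lborel) \<partial>lborel)"
    by (intro nn_integral_cmult) measurable
  also have "(\<integral>\<^sup>+c. (\<integral>\<^sup>+t. G c t \<partial>lborel) \<partial>lborel) = (\<integral>\<^sup>+t. (\<integral>\<^sup>+c. G c t \<partial>lborel) \<partial>lborel)"
    by (rule lborel_pair.Fubini'[symmetric]) measurable
  also have "\<dots> \<le> (\<integral>\<^sup>+t. (\<integral>\<^sup>+z. ennreal (cmod (f z)) * indicator (ball w (2 * r)) z \<partial>lborel) * indicator {0..1} t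
      \<partial>(lborel :: real measure))"
  proof (intro nn_integral_mono)
    fix t :: real
    define v where "v = circlepath 0 r t"
    have v: "circlepath c r t = v + c" for c by (simp add: v_def circlepath)
    have norm_v: "norm v = r" using r by (simp add: v_def circlepath norm_mult)
    have "(\<integral>\<^sup>+c. G c t \<partial>lborel) \<le>
        (\<integral>\<^sup>+c. ennreal (cmod (f (v + c))) * indicator (ball w (2 * r)) (v + c) * indicator {0..1} t \<partial>lborel)"
    proof (intro nn_integral_mono)
      fix c
      have "v + c \<in> ball w (2 * r)" if "c \<in> ball w (r / 2)"
        using that norm_triangle_ineq4[of "w - c" v] norm_v r by (simp add: dist_norm algebra_simps)
      then show "G c t \<le> ennreal (cmod (f (v + c))) * indicator (ball w (2 * r)) (v + c) * indicator {0..1} t"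
        by (auto simp: G_def v indicator_def)
    qed
    also have "\<dots> = (\<integral>\<^sup>+c. ennreal (cmod (f (v + c))) * indicator (ball w (2 * r)) (v + c) \<partial>lborel) * indicator {0..1} t"
      by (intro nn_integral_multc) measurable
    also have "(\<integral>\<^sup>+c. ennreal (cmod (f (v + c))) * indicator (ball w (2 * r)) (v + c) \<partial>lborel)
        = (\<integral>\<^sup>+z. ennreal (cmod (f z)) * indicator (ball w (2 * r)) z \<partial>distr lborel borel ((+) v))"
      by (subst nn_integral_distr) measurable
    finally show "(\<integral>\<^sup>+c. G c t \<partial>lborel) \<le>
        (\<integral>\<^sup>+z. ennreal (cmod (f z)) * indicator (ball w (2 * r)) z \<partial>lborel) * indicator {0..1} t"
      by (simp only: lborel_distr_plus)
  qed
  also have "\<dots> = (\<integral>\<^sup>+z. ennreal (cmod (f z)) * indicator (ball w (2 * r)) z \<partial>lborel)"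
    by (simp add: nn_integral_cmult_indicator)
  finally show ?thesis by (simp add: mult_left_mono)
qed

section \<open>Square-integrable functions on the half-plane\<close>

lemma open_upper_half_plane: "open upper_half_plane"
  unfolding upper_half_plane_def by (rule open_halfspace_Im_gt)

lemma upper_half_plane_borel [measurable]: "upper_half_plane \<in> sets borel"
  using open_upper_half_plane by simp

lemma nn_integral_half_plane:
  "(\<integral>\<^sup>+z. g z \<partial>lebesgue_on upper_half_plane) = (\<integral>\<^sup>+z. g z * indicator upper_half_plane z \<partial>lborel)"
  using upper_half_plane_borel by (simp add: nn_integral_restrict_space nn_integral_completion)

lemma borel_measurable_half_plane:
  "f \<in> borel_measurable borel \<Longrightarrow> f \<in> borel_measurable (lebesgue_on upper_half_plane)"
  by (intro measurable_restrict_space1 measurable_completion) simp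

lemma L2_measurable [measurable_dest]:
  "f \<in> L2_functions \<Longrightarrow> f \<in> borel_measurable (lebesgue_on upper_half_plane)"
  by (simp add: L2_functions_def)

lemma L2_integrable:
  "f \<in> L2_functions \<Longrightarrow> integrable (lebesgue_on upper_half_plane) (\<lambda>z. (cmod (f z))\<^sup>2)"
  by (simp add: L2_functions_def)

lemma L2_product_integrable:
  assumes f: "f \<in> L2_functions" and g: "g \<in> L2_functions"
  shows "integrable (lebesgue_on upper_half_plane) (\<lambda>z. f z * cnj (g z))"
proof (rule Bochner_Integration.integrable_bound)
  show "integrable (lebesgue_on upper_half_plane) (\<lambda>z. (cmod (f z))\<^sup>2 + (cmod (g z))\<^sup>2)"
    using f g by (intro Bochner_Integration.integrable_add L2_integrable)
  show "(\<lambda>z. f z * cnj (g z)) \<in> borel_measurable (lebesgue_on upper_half_plane)"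
    by (intro borel_measurable_times borel_measurable_continuous_on[OF _ L2_measurable[OF g]]
       L2_measurable[OF f] continuous_intros)
  have "cmod (f z * cnj (g z)) \<le> (cmod (f z))\<^sup>2 + (cmod (g z))\<^sup>2" for z
  proof -
    have "2 * (cmod (f z) * cmod (g z)) \<le> (cmod (f z))\<^sup>2 + (cmod (g z))\<^sup>2"
      using sum_squares_bound[of "cmod (f z)" "cmod (g z)"] by (simp add: mult.assoc)
    moreover have "0 \<le> cmod (f z) * cmod (g z)" by simp
    ultimately show ?thesis unfolding norm_mult complex_mod_cnj by linarith
  qed
  then show "AE z in lebesgue_on upper_half_plane.
      cmod (f z * cnj (g z)) \<le> norm ((cmod (f z))\<^sup>2 + (cmod (g z))\<^sup>2)" by simp
qed

lemma L2_add:
  assumes f: "f \<in> L2_functions" and g: "g \<in> L2_functions"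
  shows "(\<lambda>z. f z + g z) \<in> L2_functions"
proof -
  note [measurable] = L2_measurable[OF f] L2_measurable[OF g]
  have "integrable (lebesgue_on upper_half_plane) (\<lambda>z. (cmod (f z + g z))\<^sup>2)"
  proof (rule Bochner_Integration.integrable_bound)
    show "integrable (lebesgue_on upper_half_plane) (\<lambda>z. 2 * (cmod (f z))\<^sup>2 + 2 * (cmod (g z))\<^sup>2)"
      using f g by (intro Bochner_Integration.integrable_add integrable_mult_right L2_integrable)
    have "(cmod (f z + g z))\<^sup>2 \<le> 2 * (cmod (f z))\<^sup>2 + 2 * (cmod (g z))\<^sup>2" for z
      using power_mono[OF norm_triangle_ineq[of "f z" "g z"], of 2] sum_squares_bound[of "cmod (f z)" "cmod (g z)"]
      by (simp add: power2_sum)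
    then show "AE z in lebesgue_on upper_half_plane.
        norm ((cmod (f z + g z))\<^sup>2) \<le> norm (2 * (cmod (f z))\<^sup>2 + 2 * (cmod (g z))\<^sup>2)" by simp
  qed measurable
  then show ?thesis by (simp add: L2_functions_def)
qed

lemma L2_scale:
  assumes f: "f \<in> L2_functions" shows "(\<lambda>z. c * f z) \<in> L2_functions"
  using integrable_mult_right[OF L2_integrable[OF f], of "(cmod c)\<^sup>2"] L2_measurable[OF f]
  by (simp add: L2_functions_def norm_mult power_mult_distrib)

lemma L2_diff: "f \<in> L2_functions \<Longrightarrow> g \<in> L2_functions \<Longrightarrow> (\<lambda>z. f z - g z) \<in> L2_functions"
  using L2_add[of f "\<lambda>z. - 1 * g z"] L2_scale[of g "-1"] by simp

lemma L2_zero: "(\<lambda>z. 0) \<in> L2_functions"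
  by (simp add: L2_functions_def)

lemma L2_indicator_mult:
  assumes E: "E \<in> sets borel" and f: "f \<in> L2_functions"
  shows "(\<lambda>z. indicator E z * f z) \<in> L2_functions"
proof -
  have [measurable]: "(indicator E :: complex \<Rightarrow> complex) \<in> borel_measurable (lebesgue_on upper_half_plane)"
    using E by (intro borel_measurable_half_plane borel_measurable_indicator)
  note [measurable] = L2_measurable[OF f]
  have "integrable (lebesgue_on upper_half_plane) (\<lambda>z. (cmod (indicator E z * f z))\<^sup>2)"
  proof (rule Bochner_Integration.integrable_bound[OF L2_integrable[OF f]])
    show "AE z in lebesgue_on upper_half_plane. norm ((cmod (indicator E z * f z))\<^sup>2) \<le> norm ((cmod (f z))\<^sup>2)"
      by (auto simp: indicator_def)
  qed measurable
  then show ?thesis by (simp add: L2_functions_def)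
qed

lemma L2_inner_add_left:
  "f \<in> L2_functions \<Longrightarrow> g \<in> L2_functions \<Longrightarrow> h \<in> L2_functions \<Longrightarrow>
    L2_inner (\<lambda>z. f z + g z) h = L2_inner f h + L2_inner g h"
  by (simp add: L2_inner_def distrib_right L2_product_integrable)

lemma L2_inner_diff_left:
  "f \<in> L2_functions \<Longrightarrow> g \<in> L2_functions \<Longrightarrow> h \<in> L2_functions \<Longrightarrow>
    L2_inner (\<lambda>z. f z - g z) h = L2_inner f h - L2_inner g h"
  by (simp add: L2_inner_def left_diff_distrib L2_product_integrable)

lemma L2_inner_scale_left: "L2_inner (\<lambda>z. c * f z) h = c * L2_inner f h"
  by (simp add: L2_inner_def mult.assoc)

lemma L2_inner_cnj: "L2_inner g f = cnj (L2_inner f g)"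
  unfolding L2_inner_def Bochner_Integration.integral_cnj[symmetric] by (simp add: mult.commute)

lemma L2_inner_self:
  "L2_inner f f = of_real (\<integral>z. (cmod (f z))\<^sup>2 \<partial>lebesgue_on upper_half_plane)"
  unfolding L2_inner_def complex_norm_square[symmetric] by (rule integral_complex_of_real)

lemma L2_inner_self_nonneg: "0 \<le> Re (L2_inner f f)"
  by (simp add: L2_inner_self)

lemma L2_inner_diff_self:
  assumes f: "f \<in> L2_functions" and g: "g \<in> L2_functions"
  shows "Re (L2_inner (\<lambda>z. f z - g z) (\<lambda>z. f z - g z)) =
    Re (L2_inner f f) - 2 * Re (L2_inner f g) + Re (L2_inner g g)"
  using f g L2_diff[OF f g] L2_inner_cnj[of f "\<lambda>z. f z - g z"] L2_inner_cnj[of g "\<lambda>z. f z - g z"]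
    L2_inner_cnj[of f g]
  by (simp add: L2_inner_diff_left)

lemma L2_Cauchy_Schwarz:
  assumes f: "f \<in> L2_functions" and g: "g \<in> L2_functions"
  shows "(cmod (L2_inner f g))\<^sup>2 \<le> Re (L2_inner f f) * Re (L2_inner g g)"
proof (rule Cauchy_Schwarz_of_nonneg_form)
  fix c
  let ?cg = "\<lambda>z. c * g z"
  have inner: "L2_inner f ?cg = cnj c * L2_inner f g" "L2_inner ?cg ?cg = of_real ((cmod c)\<^sup>2) * L2_inner g g"
  proof -
    show *: "L2_inner f ?cg = cnj c * L2_inner f g" for f
      using L2_inner_cnj[of f ?cg] L2_inner_cnj[of f g] by (simp add: L2_inner_scale_left)
    show "L2_inner ?cg ?cg = of_real ((cmod c)\<^sup>2) * L2_inner g g"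
      unfolding * L2_inner_scale_left complex_norm_square by simp
  qed
  have "0 \<le> Re (L2_inner (\<lambda>z. f z - ?cg z) (\<lambda>z. f z - ?cg z))" by (rule L2_inner_self_nonneg)
  also have "\<dots> = Re (L2_inner f f) - 2 * Re (cnj c * L2_inner f g) + (cmod c)\<^sup>2 * Re (L2_inner g g)"
    unfolding L2_inner_diff_self[OF f L2_scale[OF g]] inner L2_inner_self[of g] by simp
  finally show "0 \<le> Re (L2_inner f f) - 2 * Re (cnj c * L2_inner f g) + (cmod c)\<^sup>2 * Re (L2_inner g g)" .
qed (rule L2_inner_self_nonneg)

section \<open>The Bergman space\<close>

lemma bergman_space_simps [simp]:
  "hscale bergman_space c f = (\<lambda>z. c * f z)"
  "hinner bergman_space = L2_inner"
  by (simp_all add: bergman_space_def)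

lemma bergman_carrier:
  "f \<in> hcarrier bergman_space \<longleftrightarrow> f holomorphic_on upper_half_plane \<and> f \<in> L2_functions \<and>
    (\<forall>z. z \<notin> upper_half_plane \<longrightarrow> f z = 0)"
  by (simp add: bergman_space_def)

lemma bergman_L2: "f \<in> hcarrier bergman_space \<Longrightarrow> f \<in> L2_functions"
  by (simp add: bergman_carrier)

lemma borel_measurable_if_holomorphic_half_plane:
  assumes "f holomorphic_on upper_half_plane" "\<And>z. z \<notin> upper_half_plane \<Longrightarrow> f z = 0"
  shows "f \<in> borel_measurable borel"
proof -
  have "f = (\<lambda>z. indicator upper_half_plane z *\<^sub>R f z)"
    using assms(2) by (auto simp: fun_eq_iff indicator_def)
  then show ?thesis
    using borel_measurable_continuous_on_indicator[OF upper_half_plane_borel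
        holomorphic_on_imp_continuous_on[OF assms(1)]] by simp
qed

lemma hnorm_bergman_square:
  "(hnorm bergman_space f)\<^sup>2 = (\<integral>z. (cmod (f z))\<^sup>2 \<partial>lebesgue_on upper_half_plane)"
  unfolding hnorm_def by (simp add: L2_inner_self)

lemma nn_integral_bergman:
  assumes "f \<in> L2_functions"
  shows "(\<integral>\<^sup>+z. ennreal ((cmod (f z))\<^sup>2) \<partial>lebesgue_on upper_half_plane) = ennreal ((hnorm bergman_space f)\<^sup>2)"
  unfolding hnorm_bergman_square using L2_integrable[OF assms] by (intro nn_integral_eq_integral) auto

text \<open>
  The area estimate is applied to the holomorphic function \<open>f\<^sup>2\<close>, which yields the \<open>L\<^sub>2\<close> norm
  directly.
\<close>

lemma bergman_local_estimate:
  assumes f: "f \<in> hcarrier bergman_space" and r: "0 < r" and w: "ball w (2 * r) \<subseteq> upper_half_plane"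
  shows "ennreal ((cmod (f w))\<^sup>2 * measure lborel (ball w (r / 2))) \<le>
    2 * (\<integral>\<^sup>+z. ennreal ((cmod (f z))\<^sup>2) * indicator (ball w (2 * r)) z \<partial>lborel)"
proof -
  have "f \<in> borel_measurable borel"
    using f by (intro borel_measurable_if_holomorphic_half_plane) (auto simp: bergman_carrier)
  then have "(\<lambda>z. (f z)\<^sup>2) \<in> borel_measurable borel" by measurable
  moreover have "(\<lambda>z. (f z)\<^sup>2) holomorphic_on ball w (2 * r)"
    using f w by (auto simp: bergman_carrier intro!: holomorphic_intros intro: holomorphic_on_subset)
  ultimately show ?thesis
    using cmod_le_area_integral[of "\<lambda>z. (f z)\<^sup>2" w r] r by (simp add: norm_power)
qed

text \<open>
  Point evaluations are bounded, uniformly on half-planes \<open>Im w \<ge> 2 r\<close>. Consequently convergence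
  in the Bergman norm is locally uniform, and limits stay holomorphic.
\<close>

lemma bergman_point_evaluation:
  assumes r: "0 < r"
  obtains C where "0 < C"
    "\<And>f w. f \<in> hcarrier bergman_space \<Longrightarrow> 2 * r \<le> Im w \<Longrightarrow> cmod (f w) \<le> C * hnorm bergman_space f"
proof -
  define A where "A = measure lborel (ball (0::complex) (r / 2))"
  have A: "0 < A" using r by (simp add: A_def content_ball_pos)
  have A_eq: "measure lborel (ball w (r / 2)) = A" for w :: complex
    unfolding A_def using r by (subst (1 2) content_ball_conv_unit_ball) auto
  show ?thesis
  proof (rule that[of "sqrt (2 / A)"])
    fix f w assume f: "f \<in> hcarrier bergman_space" and w: "2 * r \<le> Im w"
    have sub: "ball w (2 * r) \<subseteq> upper_half_plane"
    proof
      fix z assume "z \<in> ball w (2 * r)"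
      then show "z \<in> upper_half_plane"
        using abs_Im_le_cmod[of "w - z"] w by (simp add: upper_half_plane_def dist_norm)
    qed
    have "ennreal ((cmod (f w))\<^sup>2 * A) \<le>
        2 * (\<integral>\<^sup>+z. ennreal ((cmod (f z))\<^sup>2) * indicator (ball w (2 * r)) z \<partial>lborel)"
      using bergman_local_estimate[OF f r sub] by (simp add: A_eq)
    also have "\<dots> \<le> 2 * (\<integral>\<^sup>+z. ennreal ((cmod (f z))\<^sup>2) * indicator upper_half_plane z \<partial>lborel)"
      using sub by (intro mult_left_mono nn_integral_mono) (auto simp: indicator_def)
    also have "\<dots> = ennreal (2 * (hnorm bergman_space f)\<^sup>2)"
      using nn_integral_bergman[OF bergman_L2[OF f]] by (simp add: nn_integral_half_plane ennreal_mult)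
    finally have "(cmod (f w))\<^sup>2 * A \<le> 2 * (hnorm bergman_space f)\<^sup>2" by simp
    then have "(cmod (f w))\<^sup>2 \<le> (sqrt (2 / A) * hnorm bergman_space f)\<^sup>2"
      using A by (simp add: power_mult_distrib field_simps)
    moreover have "0 \<le> sqrt (2 / A) * hnorm bergman_space f"
      using A by (simp add: hnorm_def L2_inner_self)
    ultimately show "cmod (f w) \<le> sqrt (2 / A) * hnorm bergman_space f"
      by (rule power2_le_imp_le)
  qed (use A in simp)
qed

lemma vector_space_bergman: "vector_space (hscale bergman_space)"
  by unfold_locales (auto simp: fun_eq_iff algebra_simps)

lemma bergman_diff:
  "f \<in> hcarrier bergman_space \<Longrightarrow> g \<in> hcarrier bergman_space \<Longrightarrow> f - g \<in> hcarrier bergman_space"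
  using L2_diff[of f g] by (auto simp: bergman_carrier fun_diff_def intro!: holomorphic_intros)

lemma bergman_pointwise_limit:
  assumes X: "\<And>i. X i \<in> hcarrier bergman_space"
    and Cauchy: "\<forall>e>0. \<exists>N. \<forall>i\<ge>N. \<forall>j\<ge>N. hnorm bergman_space (X i - X j) < e"
  obtains g where "g holomorphic_on upper_half_plane" "\<And>z. z \<notin> upper_half_plane \<Longrightarrow> g z = 0"
    "\<And>z. (\<lambda>i. X i z) \<longlonglongrightarrow> g z"
proof -
  have uniform: "uniformly_Cauchy_on {w. 2 * r \<le> Im w} X" if r: "0 < r" for r
    unfolding uniformly_Cauchy_on_def
  proof (intro allI impI)
    fix e :: real assume e: "0 < e"
    obtain C where C: "0 < C" and bound:
      "\<And>f w. f \<in> hcarrier bergman_space \<Longrightarrow> 2 * r \<le> Im w \<Longrightarrow> cmod (f w) \<le> C * hnorm bergman_space f"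
      using bergman_point_evaluation[OF r] by metis
    obtain N where N: "\<And>i j. N \<le> i \<Longrightarrow> N \<le> j \<Longrightarrow> hnorm bergman_space (X i - X j) < e / C"
      using Cauchy e C by (metis divide_pos_pos)
    have "dist (X i w) (X j w) < e" if "2 * r \<le> Im w" "N \<le> i" "N \<le> j" for w i j
    proof -
      have "cmod ((X i - X j) w) \<le> C * hnorm bergman_space (X i - X j)"
        using X that bound bergman_diff by blast
      also have "\<dots> < e" using N[OF that(2,3)] C by (simp add: field_simps)
      finally show ?thesis by (simp add: dist_norm)
    qed
    then show "\<exists>M. \<forall>x\<in>{w. 2 * r \<le> Im w}. \<forall>m\<ge>M. \<forall>n\<ge>M. dist (X m x) (X n x) < e"
      by blast
  qed
  define g where "g z = lim (\<lambda>i. X i z)" for z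
  have outside: "X i z = 0" if "z \<notin> upper_half_plane" for i z
    using X[of i] that by (simp add: bergman_carrier)
  have uniform_limit: "uniform_limit {w. 2 * r \<le> Im w} X g sequentially" if "0 < r" for r
    using uniform[OF that] unfolding g_def uniformly_convergent_eq_Cauchy[symmetric]
    by (rule uniformly_convergent_uniform_limit_iff[THEN iffD1])
  have lim: "(\<lambda>i. X i z) \<longlonglongrightarrow> g z" for z
  proof (cases "z \<in> upper_half_plane")
    case True
    then have "0 < Im z / 2" by (simp add: upper_half_plane_def)
    from tendsto_uniform_limitI[OF uniform_limit[OF this]] show ?thesis by simp
  next
    case False
    then show ?thesis by (simp add: g_def outside)
  qed
  have "g holomorphic_on upper_half_plane"
  proof (rule holomorphic_uniform_sequence[OF open_upper_half_plane])
    show "X n holomorphic_on upper_half_plane" for n using X by (simp add: bergman_carrier)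
    fix z assume z: "z \<in> upper_half_plane"
    define d where "d = Im z / 2"
    have d: "0 < d" using z by (simp add: d_def upper_half_plane_def)
    have sub: "cball z d \<subseteq> {w. 2 * (d / 2) \<le> Im w}"
    proof
      fix w assume "w \<in> cball z d"
      then have "Im z - Im w \<le> d"
        using abs_Im_le_cmod[of "z - w"] by (simp add: dist_norm)
      then show "w \<in> {w. 2 * (d / 2) \<le> Im w}" by (simp add: d_def)
    qed
    have "uniform_limit (cball z d) X g sequentially"
      using uniform_limit[of "d / 2"] d sub by (auto intro: uniform_limit_on_subset)
    moreover have "cball z d \<subseteq> upper_half_plane"
      using sub d by (auto simp: upper_half_plane_def)
    ultimately show "\<exists>d. 0 < d \<and> cball z d \<subseteq> upper_half_plane \<and> uniform_limit (cball z d) X g sequentially"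
      using d by blast
  qed
  moreover have "g z = 0" if "z \<notin> upper_half_plane" for z
    using that by (simp add: g_def outside)
  ultimately show ?thesis using that lim by blast
qed

text \<open>
  The pointwise limit of a Cauchy sequence is a limit in norm by Fatou's lemma:
  \<open>\<integral> |X\<^sub>i - g|\<^sup>2 \<le> liminf\<^sub>j \<integral> |X\<^sub>i - X\<^sub>j|\<^sup>2\<close>.
\<close>

lemma bergman_complete:
  assumes X: "\<And>i. X i \<in> hcarrier bergman_space"
    and Cauchy: "\<forall>e>0. \<exists>N. \<forall>i\<ge>N. \<forall>j\<ge>N. hnorm bergman_space (X i - X j) < e"
  shows "\<exists>g\<in>hcarrier bergman_space. (\<lambda>i. hnorm bergman_space (X i - g)) \<longlonglongrightarrow> 0"
proof -
  let ?M = "lebesgue_on upper_half_plane"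
  obtain g where holo: "g holomorphic_on upper_half_plane" and zero: "\<And>z. z \<notin> upper_half_plane \<Longrightarrow> g z = 0"
    and lim: "\<And>z. (\<lambda>i. X i z) \<longlonglongrightarrow> g z" using bergman_pointwise_limit[OF assms] by metis
  have [measurable]: "g \<in> borel_measurable ?M"
    by (intro borel_measurable_half_plane borel_measurable_if_holomorphic_half_plane holo zero)
  have [measurable]: "X i \<in> borel_measurable ?M" for i
    using L2_measurable[OF bergman_L2[OF X]] .
  have Fatou: "(\<integral>\<^sup>+z. ennreal ((cmod (X i z - g z))\<^sup>2) \<partial>?M) \<le> ennreal (e\<^sup>2)"
    if N: "\<And>j. N \<le> j \<Longrightarrow> hnorm bergman_space (X i - X j) < e" for i N e
  proof -
    have "(\<lambda>j. ennreal ((cmod (X i z - X j z))\<^sup>2)) \<longlonglongrightarrow> ennreal ((cmod (X i z - g z))\<^sup>2)" for z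
      by (intro tendsto_ennrealI tendsto_intros lim)
    then have "(\<integral>\<^sup>+z. ennreal ((cmod (X i z - g z))\<^sup>2) \<partial>?M)
        = (\<integral>\<^sup>+z. liminf (\<lambda>j. ennreal ((cmod (X i z - X j z))\<^sup>2)) \<partial>?M)"
      by (intro nn_integral_cong lim_imp_Liminf[symmetric]) simp_all
    also have "\<dots> \<le> liminf (\<lambda>j. \<integral>\<^sup>+z. ennreal ((cmod (X i z - X j z))\<^sup>2) \<partial>?M)"
      by (intro nn_integral_liminf) measurable
    also have "\<dots> \<le> ennreal (e\<^sup>2)"
    proof (intro Liminf_le eventually_sequentiallyI[of N])
      fix j assume "N \<le> j"
      have "(\<integral>\<^sup>+z. ennreal ((cmod (X i z - X j z))\<^sup>2) \<partial>?M) = ennreal ((hnorm bergman_space (X i - X j))\<^sup>2)"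
        using nn_integral_bergman[OF bergman_L2[OF bergman_diff[OF X X]], of i j] by simp
      also have "\<dots> \<le> ennreal (e\<^sup>2)"
        using N[OF \<open>N \<le> j\<close>] by (intro ennreal_leI power_mono) (auto simp: hnorm_def L2_inner_self)
      finally show "(\<integral>\<^sup>+z. ennreal ((cmod (X i z - X j z))\<^sup>2) \<partial>?M) \<le> ennreal (e\<^sup>2)" .
    qed simp
    finally show ?thesis .
  qed
  have diff_L2: "(\<lambda>z. X i z - g z) \<in> L2_functions"
    if N: "\<And>j. N \<le> j \<Longrightarrow> hnorm bergman_space (X i - X j) < e" for i N e
  proof -
    have "integrable ?M (\<lambda>z. (cmod (X i z - g z))\<^sup>2)"
    proof (rule integrableI_bounded)
      have "(\<integral>\<^sup>+z. ennreal ((cmod (X i z - g z))\<^sup>2) \<partial>?M) \<le> ennreal (e\<^sup>2)" using N by (rule Fatou)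
      also have "\<dots> < \<infinity>" by simp
      finally show "(\<integral>\<^sup>+z. ennreal (norm ((cmod (X i z - g z))\<^sup>2)) \<partial>?M) < \<infinity>" by simp
    qed measurable
    then show ?thesis by (simp add: L2_functions_def)
  qed
  \<comment> \<open>\<open>g\<close> is square-integrable because \<open>g = X\<^sub>N - (X\<^sub>N - g)\<close> for large \<open>N\<close>.\<close>
  obtain N where N: "\<forall>i\<ge>N. \<forall>j\<ge>N. hnorm bergman_space (X i - X j) < 1"
    using Cauchy[rule_format, of 1] by auto
  have "(\<lambda>z. X N z - (X N z - g z)) \<in> L2_functions"
  proof (rule L2_diff[OF bergman_L2[OF X]])
    show "(\<lambda>z. X N z - g z) \<in> L2_functions" using N by (intro diff_L2[of N N 1]) blast
  qed
  then have g: "g \<in> hcarrier bergman_space"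
    using holo zero by (simp add: bergman_carrier)
  moreover have "(\<lambda>i. hnorm bergman_space (X i - g)) \<longlonglongrightarrow> 0"
  proof (rule LIMSEQ_I)
    fix e :: real assume e: "0 < e"
    then obtain N where N: "\<And>i j. N \<le> i \<Longrightarrow> N \<le> j \<Longrightarrow> hnorm bergman_space (X i - X j) < e / 2"
      using Cauchy by (metis half_gt_zero)
    have "norm (hnorm bergman_space (X i - g) - 0) < e" if "N \<le> i" for i
    proof -
      have "ennreal ((hnorm bergman_space (X i - g))\<^sup>2) \<le> ennreal ((e / 2)\<^sup>2)"
        using Fatou[of N i "e / 2", OF N[OF that]]
        unfolding nn_integral_bergman[OF bergman_L2[OF bergman_diff[OF X g]], of i, symmetric] by simp
      then have "(hnorm bergman_space (X i - g))\<^sup>2 \<le> (e / 2)\<^sup>2"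
        by (subst (asm) ennreal_le_iff) simp_all
      then have "hnorm bergman_space (X i - g) \<le> e / 2"
        by (rule power2_le_imp_le) (use e in simp)
      then show ?thesis using e by (simp add: hnorm_def L2_inner_self)
    qed
    then show "\<exists>N. \<forall>i\<ge>N. norm (hnorm bergman_space (X i - g) - 0) < e" by blast
  qed
  ultimately show ?thesis by blast
qed

interpretation bergman: hilbert_space bergman_space
proof (intro hilbert_space.intro hilbert_space_axioms.intro)
  show "vector_space (hscale bergman_space)" by (rule vector_space_bergman)
  interpret vector_space "hscale bergman_space" by (rule vector_space_bergman)
  show "subspace (hcarrier bergman_space)"
    unfolding subspace_def
    by (auto simp: bergman_carrier zero_fun_def plus_fun_def L2_zero L2_add L2_scale intro!: holomorphic_intros)
  show "hinner bergman_space (x + y) z = hinner bergman_space x z + hinner bergman_space y z"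
    if "x \<in> hcarrier bergman_space" "y \<in> hcarrier bergman_space" "z \<in> hcarrier bergman_space" for x y z
    using that by (simp add: plus_fun_def L2_inner_add_left bergman_L2)
  show "hinner bergman_space (hscale bergman_space c x) y = c * hinner bergman_space x y" for c x y
    by (simp add: L2_inner_scale_left)
  show "hinner bergman_space y x = cnj (hinner bergman_space x y)" for x y
    unfolding bergman_space_simps by (rule L2_inner_cnj)
  show "0 < Re (hinner bergman_space f f)" if f: "f \<in> hcarrier bergman_space" and "f \<noteq> 0" for f
  proof -
    obtain w where w: "f w \<noteq> 0" using \<open>f \<noteq> 0\<close> by (auto simp: fun_eq_iff)
    with f have "0 < Im w" by (auto simp: bergman_carrier upper_half_plane_def)
    then obtain C where "cmod (f w) \<le> C * hnorm bergman_space f"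
      using bergman_point_evaluation[of "Im w / 2"] f by (metis half_gt_zero mult_2 field_sum_of_halves order_refl)
    then have "hnorm bergman_space f \<noteq> 0" using w by auto
    then show ?thesis
      using L2_inner_self_nonneg[of f] by (simp add: hnorm_def order_less_le)
  qed
qed (rule bergman_complete)

section \<open>Toeplitz operators with indicator symbols\<close>

text \<open>
  The functional \<open>h \<mapsto> \<langle>h, u\<rangle>\<close> is bounded on the Bergman space; its Riesz representative has the
  defining property of the orthogonal projection of \<open>u\<close>.
\<close>

lemma bergman_projection:
  assumes u: "u \<in> L2_functions"
  shows "bergman_projection u \<in> hcarrier bergman_space"
    and "h \<in> hcarrier bergman_space \<Longrightarrow> L2_inner (bergman_projection u) h = L2_inner u h"
proof -
  define M where "M = sqrt (Re (L2_inner u u))"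
  have bound: "cmod (L2_inner h u) \<le> M * hnorm bergman_space h" if h: "h \<in> hcarrier bergman_space" for h
  proof (rule power2_le_imp_le)
    show "(cmod (L2_inner h u))\<^sup>2 \<le> (M * hnorm bergman_space h)\<^sup>2"
      using L2_Cauchy_Schwarz[OF bergman_L2[OF h] u]
      by (simp add: M_def hnorm_def power_mult_distrib L2_inner_self_nonneg mult.commute)
  qed (simp add: M_def h L2_inner_self_nonneg)
  obtain g where g: "g \<in> hcarrier bergman_space"
    and riesz: "\<And>h. h \<in> hcarrier bergman_space \<Longrightarrow> hinner bergman_space h g = L2_inner h u"
  proof (rule bergman.Riesz_representation[of "\<lambda>h. L2_inner h u" M])
    show "L2_inner (x + y) u = L2_inner x u + L2_inner y u"
      if "x \<in> hcarrier bergman_space" "y \<in> hcarrier bergman_space" for x y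
      using that u by (simp add: plus_fun_def L2_inner_add_left bergman_L2)
  qed (use bound in \<open>auto simp: L2_inner_scale_left\<close>)
  have g_inner: "L2_inner g h = L2_inner u h" if h: "h \<in> hcarrier bergman_space" for h
    using riesz[OF h] L2_inner_cnj[of g h] L2_inner_cnj[of u h] by simp
  have "bergman_projection u = g"
    unfolding bergman_projection_def
  proof (rule the_equality)
    show "g \<in> hcarrier bergman_space \<and> (\<forall>h\<in>hcarrier bergman_space. L2_inner (\<lambda>z. u z - g z) h = 0)"
      using g u g_inner by (simp add: L2_inner_diff_left bergman_L2)
    fix k assume k: "k \<in> hcarrier bergman_space \<and> (\<forall>h\<in>hcarrier bergman_space. L2_inner (\<lambda>z. u z - k z) h = 0)"
    show "k = g"
      using k g u g_inner by (intro bergman.eq_if_inner_eq) (auto simp: L2_inner_diff_left bergman_L2)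
  qed
  with g g_inner show "bergman_projection u \<in> hcarrier bergman_space"
    and "h \<in> hcarrier bergman_space \<Longrightarrow> L2_inner (bergman_projection u) h = L2_inner u h" by simp_all
qed

lemma toeplitz_indicator:
  assumes E: "E \<in> sets borel" and f: "f \<in> hcarrier bergman_space"
  shows "toeplitz (indicator E) f \<in> hcarrier bergman_space"
    and "h \<in> hcarrier bergman_space \<Longrightarrow>
      L2_inner (toeplitz (indicator E) f) h = L2_inner (\<lambda>z. indicator E z * f z) h"
  unfolding toeplitz_def using bergman_projection[OF L2_indicator_mult[OF E bergman_L2[OF f]]] by auto

lemma L2_inner_indicator:
  "L2_inner (\<lambda>z. indicator E z * f z) g = L2_inner f (\<lambda>z. indicator E z * g z)"
  unfolding L2_inner_def by (intro Bochner_Integration.integral_cong) (auto simp: indicator_def)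

lemma L2_inner_indicator_self:
  "L2_inner (\<lambda>z. indicator E z * f z) (\<lambda>z. indicator E z * f z) = L2_inner (\<lambda>z. indicator E z * f z) f"
  unfolding L2_inner_def by (intro Bochner_Integration.integral_cong) (auto simp: indicator_def)

text \<open>
  \<open>T f\<close> is the orthogonal projection of \<open>\<chi>\<^sub>E f\<close>, so \<open>\<parallel>T f\<parallel>\<^sup>2 \<le> \<parallel>\<chi>\<^sub>E f\<parallel>\<^sup>2 = \<langle>T f, f\<rangle>\<close>. This
  inequality gives both \<open>\<parallel>T f\<parallel> \<le> \<parallel>f\<parallel>\<close> and \<open>\<parallel>f - T f\<parallel> \<le> \<parallel>f\<parallel>\<close>.
\<close>

lemma toeplitz_indicator_norm:
  assumes E: "E \<in> sets borel" and f: "f \<in> hcarrier bergman_space"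
  shows "(hnorm bergman_space (toeplitz (indicator E) f))\<^sup>2 \<le> Re (L2_inner (toeplitz (indicator E) f) f)"
proof -
  let ?T = "toeplitz (indicator E) f" and ?u = "\<lambda>z. indicator E z * f z"
  note T = toeplitz_indicator[OF E f]
  have "0 \<le> Re (L2_inner (\<lambda>z. ?u z - ?T z) (\<lambda>z. ?u z - ?T z))" by (rule L2_inner_self_nonneg)
  also have "\<dots> = Re (L2_inner ?u ?u) - 2 * Re (L2_inner ?u ?T) + Re (L2_inner ?T ?T)"
    by (intro L2_inner_diff_self L2_indicator_mult E bergman_L2 f T)
  also have "L2_inner ?u ?T = L2_inner ?T ?T" using T by simp
  also have "L2_inner ?u ?u = L2_inner ?T f" using T(2)[OF f] by (simp add: L2_inner_indicator_self)
  finally show ?thesis using bergman.norm_square[OF T(1)] by simp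
qed

lemma self_adjoint_toeplitz_indicator:
  assumes E: "E \<in> sets borel"
  shows "self_adjoint_operator bergman_space (toeplitz (indicator E))"
proof -
  let ?T = "toeplitz (indicator E)" and ?A = "hcarrier bergman_space"
  note T = toeplitz_indicator[OF E]
  have u: "(\<lambda>z. indicator E z * f z) \<in> L2_functions" if "f \<in> ?A" for f
    using that E by (intro L2_indicator_mult bergman_L2)
  have "bounded_operator bergman_space ?T"
    unfolding bounded_operator_def
  proof (intro conjI ballI allI exI[of _ 1])
    fix f g assume fg: "f \<in> ?A" "g \<in> ?A"
    show "?T (f + g) = ?T f + ?T g"
    proof (rule bergman.eq_if_inner_eq)
      fix h assume h: "h \<in> ?A"
      have "L2_inner (?T (f + g)) h = L2_inner (\<lambda>z. indicator E z * f z + indicator E z * g z) h"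
        using T(2)[OF bergman.add_closed[OF fg] h] by (simp add: distrib_left)
      also have "\<dots> = L2_inner (?T f) h + L2_inner (?T g) h"
        using fg h by (simp add: L2_inner_add_left u T bergman_L2)
      also have "\<dots> = L2_inner (?T f + ?T g) h"
        using bergman.inner_add_left[OF T(1)[OF fg(1)] T(1)[OF fg(2)] h] by simp
      finally show "hinner bergman_space (?T (f + g)) h = hinner bergman_space (?T f + ?T g) h" by simp
    qed (use fg T(1) bergman.add_closed in blast)+
  next
    fix c f assume f: "f \<in> ?A"
    show "?T (hscale bergman_space c f) = hscale bergman_space c (?T f)"
    proof (rule bergman.eq_if_inner_eq)
      fix h assume h: "h \<in> ?A"
      have "L2_inner (?T (hscale bergman_space c f)) h = L2_inner (\<lambda>z. c * (indicator E z * f z)) h"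
        using T(2)[OF bergman.scale_closed[OF f] h] by (simp add: mult.left_commute)
      also have "\<dots> = L2_inner (hscale bergman_space c (?T f)) h"
        using T(2)[OF f h] by (simp add: L2_inner_scale_left)
      finally show "hinner bergman_space (?T (hscale bergman_space c f)) h =
        hinner bergman_space (hscale bergman_space c (?T f)) h" by simp
    qed (use f T(1) bergman.scale_closed in blast)+
  next
    fix f assume f: "f \<in> ?A"
    show "hnorm bergman_space (?T f) \<le> 1 * hnorm bergman_space f"
    proof (cases "hnorm bergman_space (?T f) = 0")
      case False
      have "(hnorm bergman_space (?T f))\<^sup>2 \<le> hnorm bergman_space (?T f) * hnorm bergman_space f"
        using toeplitz_indicator_norm[OF E f] bergman.Re_inner_le[OF T(1)[OF f] f] by simp
      then show ?thesis using False bergman.norm_nonneg[OF T(1)[OF f]] by (simp add: power2_eq_square)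
    qed (use f bergman.norm_nonneg in simp)
  qed (rule T(1))
  moreover have "L2_inner (?T f) g = L2_inner f (?T g)" if "f \<in> ?A" "g \<in> ?A" for f g
    using T(2)[OF that] T(2)[OF that(2,1)] L2_inner_cnj[of f "?T g"]
      L2_inner_cnj[of f "\<lambda>z. indicator E z * g z"] L2_inner_indicator[of E f g] by simp
  ultimately show ?thesis by (simp add: self_adjoint_operator_def)
qed

lemma toeplitz_indicator_contraction:
  assumes E: "E \<in> sets borel" and f: "f \<in> hcarrier bergman_space"
  shows "hnorm bergman_space (f - toeplitz (indicator E) f) \<le> hnorm bergman_space f"
proof (rule power2_le_imp_le)
  let ?T = "toeplitz (indicator E) f"
  note T = toeplitz_indicator(1)[OF E f]
  have "(hnorm bergman_space (f - ?T))\<^sup>2 = (hnorm bergman_space f)\<^sup>2 - 2 * Re (L2_inner f ?T)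
      + (hnorm bergman_space ?T)\<^sup>2"
    using bergman.norm_diff_square[OF f T] by simp
  moreover have "Re (L2_inner f ?T) = Re (L2_inner ?T f)"
    using L2_inner_cnj[of f ?T] by simp
  moreover have "0 \<le> (hnorm bergman_space ?T)\<^sup>2" by simp
  ultimately show "(hnorm bergman_space (f - ?T))\<^sup>2 \<le> (hnorm bergman_space f)\<^sup>2"
    using toeplitz_indicator_norm[OF E f] by linarith
qed (rule bergman.norm_nonneg[OF f])

text \<open>
  \<open>T f = 0\<close> forces \<open>\<integral>\<^sub>E |f|\<^sup>2 = \<langle>T f, f\<rangle> = 0\<close>, so \<open>f\<close> vanishes on the open set \<open>U \<subseteq> E\<close> by the
  local estimate, and then everywhere by the identity theorem.
\<close>

lemma toeplitz_indicator_injective: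
  assumes E: "E \<in> sets borel" and U: "open U" "U \<noteq> {}" "U \<subseteq> E" "U \<subseteq> upper_half_plane"
    and f: "f \<in> hcarrier bergman_space" and T0: "toeplitz (indicator E) f = 0"
  shows "f = 0"
proof -
  let ?u = "\<lambda>z. indicator E z * f z"
  have "L2_inner ?u ?u = L2_inner (toeplitz (indicator E) f) f"
    using toeplitz_indicator(2)[OF E f f] by (simp add: L2_inner_indicator_self)
  also have "\<dots> = 0" using bergman.inner_zero_left[OF f] by (simp add: T0)
  finally have "hnorm bergman_space ?u = 0" by (simp add: hnorm_def)
  then have null: "(\<integral>\<^sup>+z. ennreal ((cmod (?u z))\<^sup>2) * indicator upper_half_plane z \<partial>lborel) = 0"
    using nn_integral_bergman[OF L2_indicator_mult[OF E bergman_L2[OF f]]] by (simp add: nn_integral_half_plane)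
  have "f w = 0" if "w \<in> U" for w
  proof -
    obtain s where s: "0 < s" "ball w s \<subseteq> U" using U(1) \<open>w \<in> U\<close> unfolding open_contains_ball by blast
    define r where "r = s / 2"
    have r: "0 < r" "ball w (2 * r) \<subseteq> U" using s by (simp_all add: r_def)
    have "ennreal ((cmod (f w))\<^sup>2 * measure lborel (ball w (r / 2))) \<le>
        2 * (\<integral>\<^sup>+z. ennreal ((cmod (f z))\<^sup>2) * indicator (ball w (2 * r)) z \<partial>lborel)"
      using U r by (intro bergman_local_estimate f) auto
    also have "\<dots> \<le> 2 * (\<integral>\<^sup>+z. ennreal ((cmod (?u z))\<^sup>2) * indicator upper_half_plane z \<partial>lborel)"
      using U r by (intro mult_left_mono nn_integral_mono) (auto simp: indicator_def)
    also have "\<dots> = 0" using null by simp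
    finally have "(cmod (f w))\<^sup>2 * measure lborel (ball w (r / 2)) \<le> 0" by (simp add: ennreal_eq_0_iff)
    moreover have "0 < measure lborel (ball w (r / 2))" using r by (intro content_ball_pos) simp
    ultimately show "f w = 0" by (simp add: mult_le_0_iff)
  qed
  moreover have "connected upper_half_plane"
    unfolding upper_half_plane_def by (intro convex_connected convex_halfspace_Im_gt)
  ultimately have "f z = 0" if "z \<in> upper_half_plane" for z
    using analytic_continuation_open[OF U(1) open_upper_half_plane U(2) _ U(4), of f "\<lambda>_. 0" z] f that
    by (simp add: bergman_carrier)
  then show "f = 0" using f by (auto simp: fun_eq_iff bergman_carrier)
qed

section \<open>The strip symbols\<close>

text \<open>
  For \<open>k = n\<close> the upper bound disappears, so the last strip is a half-plane; each strip
  contains the open strip \<open>k - 1 < Im z < k\<close>.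
\<close>

definition strip :: "nat \<Rightarrow> nat \<Rightarrow> complex set" where
  "strip n k = {z. real k - 1 \<le> Im z \<and> (k < n \<longrightarrow> Im z < real k)}"

lemma strip_symbol_eq: "k \<in> {1..n} \<Longrightarrow> strip_symbol n k = indicator (strip n k)"
  by (auto simp: fun_eq_iff strip_symbol_def strip_def indicator_def)

lemma strip_borel: "strip n k \<in> sets borel"
  unfolding strip_def by measurable

lemma strips_partition:
  assumes n: "1 \<le> n" and z: "z \<in> upper_half_plane"
  shows "(\<Sum>k=1..n. indicator (strip n k) z :: complex) = 1"
proof -
  \<comment> \<open>\<open>m\<close> is the index of the strip containing \<open>z\<close>; strips are numbered from \<open>1\<close>.\<close>
  define m where "m = min n (nat \<lfloor>Im z\<rfloor> + 1)"
  have y: "0 < Im z" using z by (simp add: upper_half_plane_def)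
  have "z \<in> strip n k \<longleftrightarrow> k = m" if "k \<in> {1..n}" for k
  proof -
    have "real k - 1 \<le> Im z \<longleftrightarrow> k \<le> nat \<lfloor>Im z\<rfloor> + 1"
      using that y by linarith
    moreover have "Im z < real k \<longleftrightarrow> nat \<lfloor>Im z\<rfloor> + 1 \<le> k"
      using y by linarith
    ultimately show ?thesis using that by (auto simp: strip_def m_def)
  qed
  then have "(\<Sum>k=1..n. indicator (strip n k) z :: complex) = (\<Sum>k=1..n. if k = m then 1 else 0)"
    by (intro sum.cong) (auto simp: indicator_def)
  also have "\<dots> = 1" using n by (simp add: m_def)
  finally show ?thesis .
qed

lemma toeplitz_strip_resolution:
  assumes n: "1 \<le> n" and f: "f \<in> hcarrier bergman_space"
  shows "(\<Sum>k=1..n. toeplitz (indicator (strip n k)) f) = f"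
proof (rule bergman.eq_if_inner_eq)
  let ?T = "\<lambda>k. toeplitz (indicator (strip n k)) f"
  show "(\<Sum>k=1..n. ?T k) \<in> hcarrier bergman_space"
    by (intro bergman.sum_closed toeplitz_indicator strip_borel f)
  fix h assume h: "h \<in> hcarrier bergman_space"
  have "L2_inner (\<Sum>k=1..n. ?T k) h = (\<Sum>k=1..n. L2_inner (?T k) h)"
    using bergman.inner_sum_left[of "{1..n}" ?T h] h by (simp add: toeplitz_indicator strip_borel f)
  also have "\<dots> = (\<Sum>k=1..n. L2_inner (\<lambda>z. indicator (strip n k) z * f z) h)"
    using h by (simp add: toeplitz_indicator strip_borel f)
  also have "\<dots> = (\<integral>z. (\<Sum>k=1..n. indicator (strip n k) z * f z * cnj (h z)) \<partial>lebesgue_on upper_half_plane)"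
    unfolding L2_inner_def
    by (rule Bochner_Integration.integral_sum[symmetric])
       (intro L2_product_integrable L2_indicator_mult strip_borel bergman_L2 f h)
  also have "\<dots> = L2_inner f h"
    unfolding L2_inner_def
    by (intro Bochner_Integration.integral_cong)
       (simp_all add: strips_partition[OF n, simplified] flip: sum_distrib_right)
  finally show "hinner bergman_space (\<Sum>k=1..n. ?T k) h = hinner bergman_space f h" by simp
qed (rule f)

theorem lemma1:
  fixes n :: nat
  assumes "n \<ge> 1"
  shows "all_but_one_generic_position (hilbert_power bergman_space n) n (P_T n) Q_Pi"
proof -
  let ?A = "hcarrier bergman_space" and ?T = "\<lambda>k. toeplitz (indicator (strip n k))"
  let ?S = "sqrt_toeplitz n"
  have S_eq: "?S k = operator_sqrt bergman_space (?T k)" if "k \<in> {1..n}" for k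
    by (simp add: sqrt_toeplitz_def strip_symbol_eq[OF that])
  have S: "self_adjoint_operator bergman_space (?S k)"
    and S_square: "\<And>f. f \<in> ?A \<Longrightarrow> ?S k (?S k f) = ?T k f" if "k \<in> {1..n}" for k
    using bergman.operator_sqrt[OF self_adjoint_toeplitz_indicator[OF strip_borel]
        toeplitz_indicator_contraction[OF strip_borel]]
    by (simp_all add: S_eq[OF that] positive_operator_def)
  have injective: "f = 0" if k: "k \<in> {1..n}" and f: "f \<in> ?A" and "?S k f = 0" for k f
  proof -
    let ?U = "{z. real k - 1 < Im z} \<inter> {z. Im z < real k}"
    have "bounded_operator bergman_space (?S k)"
      using S[OF k] by (simp add: self_adjoint_operator_def)
    then have "?S k (?S k f) = 0"
      unfolding \<open>?S k f = 0\<close> by (rule bergman.bounded_operator_zero)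
    then have "?T k f = 0" using S_square[OF k f] by metis
    moreover have "open ?U" by (intro open_Int open_halfspace_Im_gt open_halfspace_Im_lt)
    moreover have "Complex 0 (real k - 1/2) \<in> ?U" by simp
    moreover have "?U \<subseteq> strip n k" "?U \<subseteq> upper_half_plane"
      using k by (auto simp: strip_def upper_half_plane_def)
    ultimately show "f = 0"
      using toeplitz_indicator_injective[OF strip_borel _ _ _ _ f] by blast
  qed
  have "P_T n = (\<lambda>f j. if j \<in> {1..n} then \<Sum>k=1..n. ?S j (?S k (f k)) else 0)"
    by (simp add: fun_eq_iff P_T_def)
  moreover have "(\<Sum>k=1..n. ?S k (?S k f)) = f" if "f \<in> ?A" for f
    using toeplitz_strip_resolution[OF assms that] S_square[OF _ that] by simp
  ultimately show ?thesis
    using all_but_one_generic_position_of_resolution[OF bergman.hilbert_space_axioms S injective] by simp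
qed

end
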